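(* Let $A$ be an $n\times n$ binary matrix with zero diagonal and $\widetilde A=A+I_n$. The seal space $Q^n_{\mathcal{F}_A}$ is a closed manifold if and only if both of the following hold: (1) for all $1\le j_1<\dots<j_s\le n$, $\mathrm{rank}_{\mathbb{Z}_2}\big(\widetilde A^{j_1\cdots j_s}_{j_1\cdots j_s}\big)=\mathrm{rank}_{\mathbb{Z}_2}\big(\widetilde A^{j_1\cdots j_s}\big)$; (2) any collection of pairwise different row vectors of $\widetilde A$ is linearly independent over $\mathbb{Z}_2$.
   Context: $\mathcal{C}^n=\{x\in\mathbb{R}^n: -\tfrac14\le x_i\le\tfrac14\}$; $\mathbf{F}(i)$, $\mathbf{F}(-i)$ ($1\le i\le n$) are the facets in $\{x_i=\tfrac14\}$, $\{x_i=-\tfrac14\}$. Binary matrices have entries in $\mathbb{Z}_2$; $A^i_k$ denotes the $(i,k)$ entry as $0$ or $1$. $\mathcal{F}_A$ pairs $\mathbf{F}(j)$ with $\mathbf{F}(-j)$ via $\tau^A_j:\mathbf{F}(j)\to\mathbf{F}(-j)$, $\tau^A_j(x)=y$ with $y_{|j|}=-x_{|j|}$ and $y_k=(-1)^{A^{|j|}_k}x_k$ for $k\ne|j|$. $Q^n_{\mathcal{F}_A}$ is the quotient of $\mathcal{C}^n$ by the equivalence relation generated by $x\sim\tau^A_j(x)$ for $x\in\mathbf{F}(j)$. For $1\le j_1<\dots<j_s\le n$, $\widetilde A^{j_1\cdots j_s}$ is the $s\times n$ submatrix of $\widetilde A$ formed by rows $j_1,\dots,j_s$, and $\widetilde A^{j_1\cdots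 j_s}_{j_1\cdots j_s}$ is the $s\times s$ principal submatrix on rows and columns $j_1,\dots,j_s$. *)

theory Defs
  imports "HOL-Analysis.Analysis" "HOL-Library.Z2"
begin

definition seal_cube :: "(real^'n) set" where
  "seal_cube = {x. \<forall>i. -(1/4) \<le> x$i \<and> x$i \<le> 1/4}"

text \<open>The pairing map tau^A_j (depends only on |j| = i): negate coordinate i and
  every coordinate k with A^i_k = 1.\<close>
definition seal_tau :: "bit^'n^'n \<Rightarrow> 'n \<Rightarrow> real^'n \<Rightarrow> real^'n" where
  "seal_tau A i x = (\<chi> k. if k = i then - (x$k) else (if A$i$k = 1 then - (x$k) else x$k))"

definition seal_gen :: "bit^'n^'n \<Rightarrow> real^'n \<Rightarrow> real^'n \<Rightarrow> bool" where
  "seal_gen A x y \<longleftrightarrow> x \<in> seal_cube \<and> (\<exists>i. \<bar>x$i\<bar> = 1/4 \<and> y = seal_tau A i x)"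

definition seal_points :: "bit^'n^'n \<Rightarrow> (real^'n) set set" where
  "seal_points A = {{y. equivclp (seal_gen A) x y} | x. x \<in> seal_cube}"

definition seal_space :: "bit^'n^'n \<Rightarrow> (real^'n) set topology" where
  "seal_space A = topology (\<lambda>U. U \<subseteq> seal_points A \<and>
      openin (top_of_set seal_cube) (\<Union>U))"

definition closed_manifold :: "'a topology \<Rightarrow> 'n::finite itself \<Rightarrow> bool" where
  "closed_manifold X (_::'n::finite itself) \<longleftrightarrow> compact_space X \<and> Hausdorff_space X \<and>
     second_countable X \<and>
     (\<forall>p \<in> topspace X. \<exists>U. openin X U \<and> p \<in> U \<and>
        (subtopology X U) homeomorphic_space (euclidean :: (real^'n) topology))"

text \<open>Rank of the submatrix of B on rows S and columns T, realised as the rank of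
  B with all entries outside S x T replaced by 0 (same rank).\<close>
definition sub_rank :: "'a::field^'n^'m \<Rightarrow> 'm set \<Rightarrow> 'n set \<Rightarrow> nat" where
  "sub_rank B S T = rank (\<chi> i k. if i \<in> S \<and> k \<in> T then B$i$k else 0)"

end

theory Submission
  imports Defs "HOL-Homology.Homology"
begin

text \<open>The quotient by \<open>G\<close> is never inverted explicitly. Its model is a continuous
  map into a vector space whose fibres are the orbits of \<open>G\<close>: \<open>block_fold\<close>
  when the conditions hold, \<open>folded\<close> at a minimal counterexample. Chart and model then
  have the same fibres on a compact ball and Hausdorff targets, so both are quotient maps of that
  ball and their images are homeomorphic.

  Minimality enters because a smaller nonempty element of \<open>G\<close> and its complement in
  \<open>g\<close> would both satisfy the parity condition, and the condition passes to disjoint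
  unions.

  The bound \<open>k \<ge> 3\<close> is what the obstruction needs. For \<open>k = 2\<close> the
  cone over the projective line is a plane, and the degree \<open>n - k + 2\<close> equals
  \<open>n\<close>, the one degree in which Euclidean space has local homology.\<close>

text \<open>Let \<open>a\<^sub>i\<close> denote row \<open>i\<close> of \<open>A + I\<close>. The class of a point \<open>x\<close> of the cube is its orbit under the sign changes \<open>a\<^sub>i\<close>
  with \<open>i\<close> in \<open>S = {i. |x\<^sub>i| = 1/4}\<close>. Unfolding the cube at its facets shows that the seal space near this class is
  \<open>\<real>\<^sup>n / G\<close>, where \<open>G\<close> consists of all \<open>g \<subseteq> S\<close> for which \<open>\<phi> g = (\<Sum>i\<in>g. a\<^sub>i)\<close> is supported in the zero set of \<open>x\<close>, and
  \<open>g\<close> negates the coordinates in \<open>g\<close> and in the support of \<open>\<phi> g\<close>. Conditions (1) and (2) together say that every \<open>g\<close>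
  disjoint from the support of \<open>\<phi> g\<close> is a sum of pairs \<open>{i, j}\<close> with \<open>a\<^sub>i = a\<^sub>j\<close>. If so, each \<open>G\<close> consists of even sign
  changes within blocks of coordinates, and \<open>\<real>\<^sup>n / G\<close> is homeomorphic to \<open>\<real>\<^sup>n\<close>. Otherwise take a counterexample \<open>g\<close> that
  negates as few coordinates as possible, say \<open>k\<close>. Then \<open>k \<ge> 3\<close>, and at a suitable point \<open>G = {{}, g}\<close>, so the
  space is locally the product of \<open>\<real>\<^sup>n\<^sup>-\<^sup>k\<close> and the cone over the projective space of dimension \<open>k - 1\<close>. By suspension,
  its local homology in degree \<open>n - k + 2 < n\<close> is the first homology of the projective space, which is nonzero because
  of the double cover by the sphere.\<close>

section \<open>Local homology of a product with a line\<close>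

text \<open>Only the real coordinate moves. The predicate \<open>P\<close> lets the homotopy also
  respect a subset, as homotopies of pairs require.\<close>

lemma homotopic_with_straight_line:
  fixes u v :: "'a \<times> real \<Rightarrow> real"
  assumes "continuous_map (prod_topology X euclideanreal) euclideanreal u" 
      and "continuous_map (prod_topology X euclideanreal) euclideanreal v"
      and "W \<subseteq> topspace X \<times> UNIV"
      and W: "\<And>x t s. (x,t) \<in> W \<Longrightarrow> 0 \<le> s \<Longrightarrow> s \<le> 1 \<Longrightarrow> (x, (1-s) * u (x,t) + s * v (x,t)) \<in> W"
      and P: "\<And>s. 0 \<le> s \<Longrightarrow> s \<le> 1 \<Longrightarrow> P (\<lambda>z. (fst z, (1-s) * u z + s * v z))"
  shows "homotopic_with P (subtopology (prod_topology X euclideanreal) W) 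
             (subtopology (prod_topology X euclideanreal) W)
             (\<lambda>z. (fst z, u z)) (\<lambda>z. (fst z, v z))"
proof -
  let ?T = "prod_topology X euclideanreal"
  let ?I = "prod_topology (top_of_set {0..1::real}) (subtopology ?T W)"
  have sn: "continuous_map ?I ?T snd"
    by (metis continuous_map_in_subtopology continuous_map_snd)
  have fs: "continuous_map ?I euclideanreal fst"
    by (metis continuous_map_in_subtopology continuous_map_fst)
  have c: "continuous_map ?I ?T (\<lambda>z. (fst (snd z), (1 - fst z) * u (snd z) + fst z * v (snd z)))"
  proof (subst continuous_map_pairwise, intro conjI)
    show "continuous_map ?I X (fst \<circ> (\<lambda>z. (fst (snd z), (1 - fst z) * u (snd z) + fst z * v (snd z))))"
      unfolding o_def using continuous_map_compose[OF sn continuous_map_fst] by (simp add: o_def)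
    have "continuous_map ?I euclideanreal (\<lambda>z. u (snd z))" "continuous_map ?I euclideanreal (\<lambda>z. v (snd z))"
      using continuous_map_compose[OF sn assms(1)] continuous_map_compose[OF sn assms(2)] by (simp_all add: o_def)
    then show "continuous_map ?I euclideanreal (snd \<circ> (\<lambda>z. (fst (snd z), (1 - fst z) * u (snd z) + fst z * v (snd z))))"
      unfolding o_def snd_conv
      by (intro continuous_intros) (use fs in auto)
  qed
  show ?thesis
    unfolding homotopic_with_def
  proof (rule exI[of _ "\<lambda>z. (fst (snd z), (1 - fst z) * u (snd z) + fst z * v (snd z))"], intro conjI ballI)
    show "continuous_map ?I (subtopology ?T W) (\<lambda>z. (fst (snd z), (1 - fst z) * u (snd z) + fst z * v (snd z)))"
      using c W by (auto simp: continuous_map_in_subtopology)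
  qed (use P in auto)
qed

text \<open>Removing a closed half-ray instead of its endpoint gives \<open>A\<close> inside
  \<open>S\<close>. In the exact sequence of the triple the groups of \<open>(T, A)\<close> vanish,
  so the boundary map lowers the degree by one and lands in the homology of \<open>(S, A)\<close>.
  Excision and projection reduce this pair to \<open>Y\<close>.\<close>

proposition local_homology_suspension:
  assumes y: "y \<in> topspace Y" and cl: "closedin Y {y}"
  shows "relative_homology_group q (prod_topology Y euclideanreal) (topspace Y \<times> UNIV - {(y,0)})
    \<cong> relative_homology_group (q-1) Y (topspace Y - {y})"
proof -
  define T where "T = prod_topology Y euclideanreal"
  have tT: "topspace T = topspace Y \<times> UNIV" by (simp add: T_def)
  define S where "S = topspace Y \<times> (UNIV::real set) - {(y,0)}"
  define A where "A = topspace Y \<times> (UNIV::real set) - {y} \<times> {0..}"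
  define U where "U = {z \<in> S. snd z \<le> 0}"
  have AS: "A \<subseteq> S" by (auto simp: A_def S_def)
  have st: "continuous_map T euclideanreal snd" and ft: "continuous_map T Y fst"
    by (auto simp: T_def continuous_map_snd continuous_map_fst)
  have cmin: "continuous_map T euclideanreal (\<lambda>z. min (snd z) (-1))"
    using st by (intro continuous_intros) auto
  \<comment> \<open>The height of a point below 0 stays negative throughout the homotopy, so the
    point never meets the removed ray.\<close>
  have neg: "(1 - s) * min t (- 1) + s * t < 0" if "t < 0" "0 \<le> s" "s \<le> 1" for s t :: real
  proof (cases "s = 1")
    case False
    then have "(1 - s) * min t (- 1) < 0" using that by (simp add: mult_pos_neg)
    moreover have "s * t \<le> 0" using that by (simp add: mult_nonneg_nonpos)
    ultimately show ?thesis by linarith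
  qed (use that in auto)
  \<comment> \<open>\<open>T\<close> minus a closed half-ray can be pushed below the point along the ray, so \<open>H(T, A)\<close> vanishes.\<close>
  have trA: "trivial_group (relative_homology_group p T A)" for p
  proof (rule trivial_relative_homology_group_gen)
    let ?f = "\<lambda>z. (fst z, min (snd z) (-1))"
    have "continuous_map T T ?f"
      using ft cmin unfolding T_def by (simp add: continuous_map_pairwise o_def)
    then show "continuous_map T (subtopology T A) ?f"
      by (auto simp: continuous_map_in_subtopology A_def tT)
    have *: "homotopic_with (\<lambda>h. True) (subtopology T W) (subtopology T W) ?f (\<lambda>z. (fst z, snd z))"
      if "W = A \<or> W = topspace T" for W
      unfolding T_def
    proof (rule homotopic_with_straight_line)
      show "W \<subseteq> topspace Y \<times> UNIV" using that by (auto simp: A_def tT)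
      show "(x, (1 - s) * min (snd (x, t)) (- 1) + s * snd (x, t)) \<in> W"
        if "(x,t) \<in> W" "0 \<le> s" "s \<le> 1" for x t s
        using that \<open>W = A \<or> W = topspace T\<close> neg[of t s] by (auto simp: A_def tT)
    qed (use cmin st in \<open>auto simp: T_def\<close>)
    show "homotopic_with (\<lambda>h. True) (subtopology T A) (subtopology T A) ?f id"
      using *[of A] by (simp add: id_def)
    show "homotopic_with (\<lambda>h. True) T T ?f id"
      using *[of "topspace T"] by (simp add: id_def)
  qed
  have "exact_seq ([relative_homology_group (q-1) T A, relative_homology_group (q-1) (subtopology T S) A,
            relative_homology_group q T S, relative_homology_group q T A],
       [hom_induced (q-1) (subtopology T S) A T A id, hom_relboundary q T S A, hom_induced q T A T S id])"
    using homology_exactness_triple_1[OF AS, of q T] homology_exactness_triple_2[OF AS, of q T]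
    by simp
  then have "hom_relboundary q T S A \<in> iso (relative_homology_group q T S) (relative_homology_group (q-1) (subtopology T S) A)"
    by (rule very_short_exact_sequence) (auto simp: trA)
  then have 1: "relative_homology_group q T S \<cong> relative_homology_group (q-1) (subtopology T S) A"
    by (rule is_isoI)
  \<comment> \<open>Excising the lower half space leaves \<open>Y \<times> (0, \<infinity>)\<close> relative to \<open>(Y - y) \<times> (0, \<infinity>)\<close>.\<close>
  let ?TS = "subtopology T S"
  have tTS: "topspace ?TS = S" by (auto simp: tT S_def)
  have clU: "closedin ?TS U"
  proof -
    have "closedin T {z \<in> topspace T. snd z \<in> {..0}}"
      using st by (rule closedin_continuous_map_preimage) auto
    then have "closedin ?TS (S \<inter> {z \<in> topspace T. snd z \<in> {..0}})"
      by (metis closedin_subtopology inf_commute)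
    moreover have "S \<inter> {z \<in> topspace T. snd z \<in> {..0}} = U" by (auto simp: U_def tT S_def)
    ultimately show ?thesis by simp
  qed
  have opA: "openin ?TS A"
  proof -
    have "closedin T ({y} \<times> {0..})"
      unfolding T_def using cl by (simp add: closedin_prod_Times_iff)
    then have "openin T A" unfolding A_def using tT by (metis openin_diff openin_topspace)
    then show ?thesis using AS by (metis inf.absorb_iff2 openin_subtopology_Int2)
  qed
  have "?TS closure_of U \<subseteq> ?TS interior_of A"
  proof -
    have "U \<subseteq> A" by (auto simp: U_def A_def S_def)
    then show ?thesis using clU opA by (simp add: closure_of_closedin interior_of_openin)
  qed
  then have 2: "relative_homology_group (q-1) (subtopology ?TS (S - U)) (A - U) \<cong> relative_homology_group (q-1) (subtopology ?TS S) A"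
    by (intro is_isoI[OF homology_excision_axiom] AS)
  define W where "W = topspace Y \<times> {0::real<..}"
  have "subtopology ?TS (S - U) = subtopology T W"
    by (simp add: subtopology_subtopology) (rule arg_cong[where f="subtopology T"], auto simp: S_def U_def W_def)
  moreover have AU: "A - U = (topspace Y - {y}) \<times> {0<..}"
    by (auto simp: A_def U_def S_def)
  moreover have "subtopology ?TS S = ?TS" by (simp add: subtopology_subtopology)
  ultimately have 2: "relative_homology_group (q-1) (subtopology T W) ((topspace Y - {y}) \<times> {0<..}) \<cong> relative_homology_group (q-1) ?TS A"
    using 2 by simp
  have 3: "relative_homology_group (q-1) (subtopology T W) ((topspace Y - {y}) \<times> {0<..}) \<cong> relative_homology_group (q-1) Y (topspace Y - {y})"
  proof (rule homotopy_equivalent_space_imp_isomorphic_relative_homology_groups)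
    let ?g = "\<lambda>a. (a, 1::real)"
    show "continuous_map (subtopology T W) Y fst"
      using ft by (simp add: continuous_map_from_subtopology)
    have "continuous_map Y T ?g" unfolding T_def by (simp add: continuous_map_pairwise o_def)
    then show "continuous_map Y (subtopology T W) ?g"
      by (auto simp: continuous_map_in_subtopology W_def)
    show "homotopic_with (\<lambda>h. h \<in> (topspace Y - {y}) \<times> {0<..} \<rightarrow> (topspace Y - {y}) \<times> {0<..}) (subtopology T W) (subtopology T W) (?g \<circ> fst) id"
    proof -
      have pos: "0 < (1 - s) + s * t" if "0 < t" "0 \<le> s" "s \<le> 1" for s t :: real
        using that by (cases "s = 0") (auto intro: add_nonneg_pos)
      have "homotopic_with (\<lambda>h. h \<in> (topspace Y - {y}) \<times> {0<..} \<rightarrow> (topspace Y - {y}) \<times> {0<..}) (subtopology T W) (subtopology T W)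
         (\<lambda>z. (fst z, 1)) (\<lambda>z. (fst z, snd z))"
        unfolding T_def
        by (rule homotopic_with_straight_line[where u="\<lambda>z. 1" and v=snd])
           (use st pos in \<open>auto simp: T_def W_def\<close>)
      then show ?thesis by (simp add: o_def id_def)
    qed
    show "homotopic_with (\<lambda>k. k \<in> topspace Y - {y} \<rightarrow> topspace Y - {y}) Y Y (fst \<circ> ?g) id"
      by (simp add: o_def id_def)
  qed auto
  have "relative_homology_group q T S \<cong> relative_homology_group (q-1) Y (topspace Y - {y})"
    using 1 2 3 by (meson group.iso_sym group_relative_homology_group iso_trans)
  then show ?thesis by (simp add: T_def S_def)
qed

section \<open>First homology and double covers\<close>

text \<open>The cover defines a cocycle mod 2: with respect to a set-theoretic section \<open>s\<close> of \<open>p\<close>, an edge has value 1 if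
  its lift changes sheets. It is even on boundaries because triangles lift, but odd on the loop \<open>p \<circ> \<gamma>\<close>.\<close>

lemma nontrivial_homology_group_1_if_double_cover:
  fixes p :: "'a::real_normed_vector \<Rightarrow> 'b::real_normed_vector"
  assumes cov: "covering_space E p B"
    and inv: "\<And>x. x \<in> E \<Longrightarrow> -x \<in> E \<and> p (-x) = p x"
    and fib: "\<And>x y. \<lbrakk>x \<in> E; y \<in> E; p x = p y\<rbrakk> \<Longrightarrow> y = x \<or> y = -x"
    and "0 \<notin> E"
    and \<gamma>: "path \<gamma>" "path_image \<gamma> \<subseteq> E" "pathfinish \<gamma> = - pathstart \<gamma>"
  shows "\<not> trivial_group (homology_group 1 (top_of_set B))"
proof
  assume triv: "trivial_group (homology_group 1 (top_of_set B))"
  have pE: "p ` E = B" and contp: "continuous_on E p"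
    using cov by (auto simp: covering_space_def)
  have nz: "x \<noteq> - x" if "x \<in> E" for x
    using that \<open>0 \<notin> E\<close> by (metis eq_neg_iff_add_eq_0 scaleR_2 scaleR_eq_0_iff zero_neq_numeral)
  define s where "s b = (SOME x. x \<in> E \<and> p x = b)" for b
  have s: "s b \<in> E" "p (s b) = b" if "b \<in> B" for b
    using someI_ex[of "\<lambda>x. x \<in> E \<and> p x = b"] that pE by (auto simp: s_def)
  define lift where "lift f h \<longleftrightarrow> continuous_on {0..1::real} h \<and> h ` {0..1} \<subseteq> E \<and> (\<forall>t\<in>{0..1}. p (h t) = f t)" for f h
  define flips where "flips f \<longleftrightarrow> (\<exists>h. lift f h \<and> h 0 = s (f 0) \<and> h 1 \<noteq> s (f 1))" for f
  \<comment> \<open>Any lift may be used to test for a flip: the only other one is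
    \<open>- h\<close>, and it reverses the answer at both ends.\<close>
  have lift_flips: "flips f \<longleftrightarrow> ((h 0 = s (f 0)) \<noteq> (h 1 = s (f 1)))" if h: "lift f h" for f h
  proof -
    have neg: "lift f (\<lambda>t. - h t)" using h inv by (auto simp: lift_def intro!: continuous_intros)
    have uniq: "h' 1 = k 1" if "lift f h'" "lift f k" "h' 0 = k 0" for h' k
    proof (rule covering_space_lift_unique[OF cov, of h' 0 k "{0..1}" f])
      show "continuous_on {0..1} f"
      proof (rule continuous_on_eq)
        show "continuous_on {0..1} (p \<circ> h)"
          using h contp unfolding lift_def by (intro continuous_on_compose) (auto elim: continuous_on_subset)
      qed (use h in \<open>auto simp: lift_def\<close>)
      show "f \<in> {0..1} \<rightarrow> B" using h pE by (force simp: lift_def)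
      show "h' 0 = k 0" by fact
      show "continuous_on {0..1} h'" "h' \<in> {0..1} \<rightarrow> E" "continuous_on {0..1} k" "k \<in> {0..1} \<rightarrow> E"
        using that(1,2) by (auto simp: lift_def image_subset_iff)
      show "f t = p (h' t)" "f t = p (k t)" if "t \<in> {0..1}" for t
        using \<open>lift f h'\<close> \<open>lift f k\<close> that by (simp_all add: lift_def)
    qed simp_all
    have hE: "h 0 \<in> E" "h 1 \<in> E" "p (h 0) = f 0" "p (h 1) = f 1" using h by (auto simp: lift_def)
    then have fB: "f 0 \<in> B" "f 1 \<in> B" using pE by (metis imageI)+
    have h0: "s (f 0) = h 0 \<or> s (f 0) = - h 0" and h1: "s (f 1) = h 1 \<or> s (f 1) = - h 1"
      using fib[of "h 0" "s (f 0)"] fib[of "h 1" "s (f 1)"] hE s fB by auto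
    show ?thesis
    proof (cases "h 0 = s (f 0)")
      case True
      then have "flips f \<longleftrightarrow> h 1 \<noteq> s (f 1)"
        unfolding flips_def using h uniq by metis
      then show ?thesis using True by simp
    next
      case False
      then have "- h 0 = s (f 0)" using h0 by simp
      then have "flips f \<longleftrightarrow> - h 1 \<noteq> s (f 1)"
        unfolding flips_def using neg uniq[OF neg] by metis
      then show ?thesis using False h1 nz hE by metis
    qed
  qed
  define e where "e t = (\<lambda>i::nat. if i = 0 then 1 - t else if i = 1 then t else 0::real)" for t
  define w where "w f = (if flips (f \<circ> e) then 1 else 0::int)" for f
  \<comment> \<open>The linear extension of \<open>w\<close> to chains, read off as the coefficient
    of the single generator \<open>()\<close>.\<close>
  define \<theta> where "\<theta> c = poly_mapping.lookup (frag_extend (\<lambda>f. frag_cmul (w f) (frag_of ())) c) ()" for c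
  have \<theta>_diff: "\<theta> (a - b) = \<theta> a - \<theta> b" for a b
    by (simp add: \<theta>_def frag_extend_diff lookup_minus)
  have \<theta>_add: "\<theta> (a + b) = \<theta> a + \<theta> b" for a b
    by (simp add: \<theta>_def frag_extend_add lookup_add)
  have \<theta>_of: "\<theta> (frag_of f) = w f" for f
    by (simp add: \<theta>_def)
  have \<theta>_minus: "\<theta> (- c) = - \<theta> c" for c using \<theta>_diff[of 0 c] by (simp add: \<theta>_def)
  have e_in: "e t \<in> standard_simplex 1" if "t \<in> {0..1}" for t
    using that by (auto simp: e_def standard_simplex_def)
  have even_tri: "even (\<theta> (chain_boundary 2 (frag_of f)))" if f: "singular_simplex 2 (top_of_set B) f" for f
  proof -
    \<comment> \<open>A planar copy of the 2-simplex, convex in a normed space, so that the lifting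
      criterion applies; \<open>q\<close> gives the barycentric coordinates.\<close>
    define T where "T = {z::real\<times>real. 0 \<le> fst z \<and> 0 \<le> snd z \<and> fst z + snd z \<le> 1}"
    define q where "q z = (\<lambda>i::nat. if i = 0 then 1 - fst z - snd z else if i = 1 then fst z else if i = 2 then snd z else 0)" for z :: "real\<times>real"
    have "T = (({0..} \<times> {0..}) \<inter> {z. inner (1,1) z \<le> 1})"
      by (auto simp: T_def)
    then have "convex T"
      by (auto intro!: convex_Int convex_Times convex_halfspace_le)
    have qT: "q z \<in> standard_simplex 2" if "z \<in> T" for z
      using that by (auto simp: q_def T_def standard_simplex_def numeral_2_eq_2)
    have "continuous_on T q"
    proof (rule continuous_on_coordinatewise_then_product)
      fix i show "continuous_on T (\<lambda>z. q z i)"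
        unfolding q_def by (cases "i = 0"; cases "i = 1"; cases "i = 2") (auto intro!: continuous_intros)
    qed
    moreover have "continuous_on (standard_simplex 2) f" "f ` standard_simplex 2 \<subseteq> B"
      using f by (auto simp: singular_simplex_def euclidean_product_topology)
    ultimately have "continuous_on T (f \<circ> q)" "f \<circ> q \<in> T \<rightarrow> B"
      using qT by (fastforce intro!: continuous_on_compose intro: continuous_on_subset)+
    then obtain g where g: "continuous_on T g" "g \<in> T \<rightarrow> E" "\<And>z. z \<in> T \<Longrightarrow> p (g z) = f (q z)"
      using covering_space_lift[OF cov convex_imp_simply_connected[OF \<open>convex T\<close>] convex_imp_locally_path_connected[OF \<open>convex T\<close>], of "f \<circ> q"]
      by (metis comp_apply)
    have lft: "lift (singular_face 2 k f \<circ> e) (g \<circ> r)"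
      if r: "continuous_on {0..1} r" "r ` {0..1} \<subseteq> T" "\<And>t. t \<in> {0..1} \<Longrightarrow> q (r t) = simplical_face k (e t)" for k r
      unfolding lift_def
    proof (intro conjI ballI)
      show "continuous_on {0..1} (g \<circ> r)"
        using r g(1) by (intro continuous_on_compose) (auto elim: continuous_on_subset)
      show "(g \<circ> r) ` {0..1} \<subseteq> E"
        using r(2) g(2) by (auto simp: image_subset_iff Pi_iff)
      fix t :: real assume t: "t \<in> {0..1}"
      then have "p (g (r t)) = f (q (r t))"
        using r(2) by (intro g(3)) auto
      then show "p ((g \<circ> r) t) = (singular_face 2 k f \<circ> e) t"
        using r(3)[OF t] e_in[OF t] by (simp add: singular_face_def)
    qed
    have 0: "lift (singular_face 2 0 f \<circ> e) (g \<circ> (\<lambda>t. (1-t,t)))"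
      by (rule lft) (auto intro!: continuous_intros simp: T_def q_def simplical_face_def e_def fun_eq_iff)
    have 1: "lift (singular_face 2 1 f \<circ> e) (g \<circ> (\<lambda>t. (0,t)))"
      by (rule lft) (auto intro!: continuous_intros simp: T_def q_def simplical_face_def e_def fun_eq_iff)
    have 2: "lift (singular_face 2 2 f \<circ> e) (g \<circ> (\<lambda>t. (t,0)))"
      by (rule lft) (auto intro!: continuous_intros simp: T_def q_def simplical_face_def e_def fun_eq_iff)
    have ends: "(singular_face 2 k f \<circ> e) t = f (q z)" if "simplical_face k (e t) = q z" "t \<in> {0..1}" for k t z
      using that e_in by (auto simp: singular_face_def)
    have vals: "(singular_face 2 0 f \<circ> e) 0 = f (q (1,0))" "(singular_face 2 0 f \<circ> e) 1 = f (q (0,1))"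
      "(singular_face 2 1 f \<circ> e) 0 = f (q (0,0))" "(singular_face 2 1 f \<circ> e) 1 = f (q (0,1))"
      "(singular_face 2 2 f \<circ> e) 0 = f (q (0,0))" "(singular_face 2 2 f \<circ> e) 1 = f (q (1,0))"
      by (rule ends; auto simp: q_def simplical_face_def e_def fun_eq_iff)+
    have "chain_boundary 2 (frag_of f) = frag_of (singular_face 2 0 f) - frag_of (singular_face 2 1 f) + frag_of (singular_face 2 2 f)"
      by (simp add: chain_boundary_of numeral_2_eq_2)
    then have "\<theta> (chain_boundary 2 (frag_of f)) = w (singular_face 2 0 f) - w (singular_face 2 1 f) + w (singular_face 2 2 f)"
      by (simp add: \<theta>_add \<theta>_diff \<theta>_of)
    \<comment> \<open>The three edges are lifted by restrictions of one lift \<open>g\<close>. Each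
      corner belongs to two edges, so the choices of \<open>s\<close> at the corners cancel mod
      2.\<close>
    then show ?thesis
      unfolding w_def lift_flips[OF 0] lift_flips[OF 1] lift_flips[OF 2] vals
      by auto
  qed
  have even_bd: "even (\<theta> (chain_boundary 2 d))" if "singular_chain 2 (top_of_set B) d" for d
    using that[unfolded singular_chain_def]
  proof (induction rule: frag_induction)
    case zero
    then show ?case by (simp add: \<theta>_def)
  next
    case (one x)
    then show ?case using even_tri by simp
  next
    case (diff a b)
    then show ?case by (simp add: chain_boundary_diff \<theta>_diff)
  qed
  define f where "f = restrict (\<lambda>x. p (\<gamma> (x 1))) (standard_simplex 1)"
  have f: "singular_simplex 1 (top_of_set B) f"
  proof -
    have c1: "continuous_on (standard_simplex 1) (\<lambda>x::nat\<Rightarrow>real. x 1)"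
      by (rule continuous_on_subset[OF continuous_on_product_coordinates]) auto
    have r1: "(\<lambda>x::nat\<Rightarrow>real. x 1) ` standard_simplex 1 \<subseteq> {0..1}"
      by (auto simp: standard_simplex_def)
    have "continuous_on {0..1} (p \<circ> \<gamma>)"
      using \<gamma> contp unfolding path_def path_image_def
      by (intro continuous_on_compose) (auto elim: continuous_on_subset)
    then have "continuous_on (standard_simplex 1) ((p \<circ> \<gamma>) \<circ> (\<lambda>x. x 1))"
      using continuous_on_subset r1 by (blast intro: continuous_on_compose[OF c1])
    then have "continuous_on (standard_simplex 1) f"
      by (rule continuous_on_eq) (auto simp: f_def)
    moreover have "f ` standard_simplex 1 \<subseteq> B"
      using r1 \<gamma>(2) pE by (force simp: f_def path_image_def)
    ultimately show ?thesis
      by (auto simp: singular_simplex_def euclidean_product_topology f_def)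
  qed
  have "\<gamma> 0 \<in> E" using \<gamma> by (auto simp: path_image_def)
  then have "p (\<gamma> 1) = p (\<gamma> 0)"
    using \<gamma> inv[of "\<gamma> 0"] by (auto simp: pathfinish_def pathstart_def path_image_def)
  then have "singular_face 1 0 f = singular_face 1 1 f"
    using simplical_face_in_standard_simplex[of 1 0 "\<lambda>j. if j = 0 then 1 else 0"] 
      simplical_face_in_standard_simplex[of 1 1 "\<lambda>j. if j = 0 then 1 else 0"]
    by (intro ext) (simp add: singular_face_def f_def restrict_def standard_simplex_0 simplical_face_def)
  then have bd0: "chain_boundary 1 (frag_of f) = 0"
    by (simp add: chain_boundary_of)
  then have "singular_relcycle 1 (top_of_set B) {} (frag_of f)"
    using f by (simp add: singular_cycle singular_chain_of)
  then have "homologous_rel_set 1 (top_of_set B) {} (frag_of f) \<in> carrier (homology_group (int 1) (top_of_set B))"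
    by (subst carrier_relative_homology_group) auto
  then have "homologous_rel_set 1 (top_of_set B) {} (frag_of f) = singular_relboundary_set 1 (top_of_set B) {}"
    using triv one_relative_homology_group[of 1 "top_of_set B" "{}"] by (simp add: trivial_group_def)
  then have "singular_relboundary 1 (top_of_set B) {} (frag_of f)"
    by (simp add: homologous_rel_set_eq_relboundary)
  then obtain d where "singular_chain 2 (top_of_set B) d" "chain_boundary 2 d = frag_of f"
    by (auto simp: singular_boundary numeral_2_eq_2)
  then have "even (w f)" using even_bd[of d] \<theta>_of[of f] by simp
  then have "\<not> flips (f \<circ> e)" by (auto simp: w_def split: if_splits)
  \<comment> \<open>The loop is lifted by a path from a point to its negative. Exactly one of the
    two is the value of \<open>s\<close>, so this edge does flip.\<close>
  moreover have "lift (f \<circ> e) \<gamma>"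
    using \<gamma> e_in by (auto simp: lift_def path_def path_image_def f_def) (auto simp: e_def)
  moreover have "(f \<circ> e) 0 = p (\<gamma> 0)" "(f \<circ> e) 1 = p (\<gamma> 1)"
    using e_in[of 0] e_in[of 1] by (auto simp: f_def e_def)
  ultimately have "(\<gamma> 0 = s (p (\<gamma> 0))) = (\<gamma> 1 = s (p (\<gamma> 0)))"
    using lift_flips[of "f \<circ> e" \<gamma>] \<open>p (\<gamma> 1) = p (\<gamma> 0)\<close> by simp
  moreover have "\<gamma> 1 = - \<gamma> 0" using \<gamma> by (auto simp: pathfinish_def pathstart_def)
  moreover have "s (p (\<gamma> 0)) = \<gamma> 0 \<or> s (p (\<gamma> 0)) = - \<gamma> 0"
  proof (rule fib)
    have "p (\<gamma> 0) \<in> B" using \<open>\<gamma> 0 \<in> E\<close> pE by auto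
    then show "s (p (\<gamma> 0)) \<in> E" "p (\<gamma> 0) = p (s (p (\<gamma> 0)))" by (simp_all add: s)
  qed fact
  ultimately show False using nz[OF \<open>\<gamma> 0 \<in> E\<close>] by argo
qed

section \<open>The quotient by an involution negating coordinates\<close>

text \<open>\<open>folded K\<close> is a model of the quotient of \<open>\<real>\<^sup>n\<close> by the involution that negates the coordinates in \<open>K\<close>. The
  products \<open>w\<^sub>i w\<^sub>j\<close> with \<open>i, j \<in> K\<close> determine these coordinates up to a common sign; each other coordinate is kept
  on the diagonal. In particular \<open>folded {}\<close> is an embedding, and \<open>folded_space K K\<close> is a cone over a real projective
  space.\<close>

definition folded :: "'n set \<Rightarrow> real^'n \<Rightarrow> real^'n^'n" where
  "folded K w = (\<chi> i j. if i \<in> K \<and> j \<in> K then w$i * w$j else if i = j then w$i else 0)"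

definition folded_space :: "'n set \<Rightarrow> 'n set \<Rightarrow> (real^'n^'n) set" where
  "folded_space K J = folded K ` {w. \<forall>i. i \<notin> J \<longrightarrow> w$i = 0}"

lemma folded_zero [simp]: "folded K 0 = 0"
  by (simp add: folded_def vec_eq_iff)

lemma zero_in_folded_space [simp]: "0 \<in> folded_space K J"
  unfolding folded_space_def by (rule image_eqI[where x=0]) auto

text \<open>One nonzero coordinate in \<open>K\<close> decides the common sign: its square fixes it
  up to sign, and its products with the other coordinates in \<open>K\<close> then determine
  those.\<close>

lemma folded_eq_iff:
  "folded K v = folded K w \<longleftrightarrow> (\<forall>i. i \<notin> K \<longrightarrow> v$i = w$i) \<and> ((\<forall>i\<in>K. v$i = w$i) \<or> (\<forall>i\<in>K. v$i = - w$i))"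
proof
  assume L: "folded K v = folded K w"
  have a: "v$i * v$j = w$i * w$j" if "i \<in> K" "j \<in> K" for i j
    using arg_cong[OF L, of "\<lambda>M. M$i$j"] that by (simp add: folded_def)
  have b: "v$i = w$i" if "i \<notin> K" for i
    using arg_cong[OF L, of "\<lambda>M. M$i$i"] that by (simp add: folded_def)
  have "(\<forall>i\<in>K. v$i = w$i) \<or> (\<forall>i\<in>K. v$i = - w$i)"
  proof (cases "\<exists>k\<in>K. w$k \<noteq> 0")
    case False
    have "v$i = w$i" if "i \<in> K" for i
    proof -
      have "w$i = 0" using False that by blast
      then show ?thesis using a[OF that that] by simp
    qed
    then show ?thesis by blast
  next
    case True
    then obtain k where k: "k \<in> K" "w$k \<noteq> 0" by blast
    have "(v$k)\<^sup>2 = (w$k)\<^sup>2"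
      using a[OF k(1) k(1)] by (simp only: power2_eq_square)
    then consider "v$k = w$k" | "v$k = - w$k"
      by (auto simp only: power2_eq_iff)
    then show ?thesis
    proof cases
      case 1
      have "v$i = w$i" if "i \<in> K" for i
        using a[OF k(1) that] k(2) unfolding 1 by simp
      then show ?thesis by blast
    next
      case 2
      have "v$i = - w$i" if "i \<in> K" for i
      proof -
        have "w$k * (v$i + w$i) = 0"
          using a[OF k(1) that] unfolding 2 by (simp add: distrib_left)
        then show ?thesis using k(2) by (simp add: eq_neg_iff_add_eq_0)
      qed
      then show ?thesis by blast
    qed
  qed
  then show "(\<forall>i. i \<notin> K \<longrightarrow> v$i = w$i) \<and> ((\<forall>i\<in>K. v$i = w$i) \<or> (\<forall>i\<in>K. v$i = - w$i))"
    using b by blast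
next
  assume R: "(\<forall>i. i \<notin> K \<longrightarrow> v$i = w$i) \<and> ((\<forall>i\<in>K. v$i = w$i) \<or> (\<forall>i\<in>K. v$i = - w$i))"
  have "folded K v $ i $ j = folded K w $ i $ j" for i j
    using R by (elim conjE disjE) (simp_all add: folded_def)
  then show "folded K v = folded K w" by (simp add: vec_eq_iff)
qed

lemma continuous_on_folded: "continuous_on S (folded K)"
  unfolding folded_def
proof (intro continuous_on_vec_lambda)
  fix i j
  show "continuous_on S (\<lambda>w. if i \<in> K \<and> j \<in> K then w$i * w$j else if i = j then w$i else 0)"
    by (cases "i \<in> K \<and> j \<in> K"; cases "i = j") (auto intro!: continuous_intros)
qed

text \<open>A coordinate outside \<open>K\<close> is visible only in its own diagonal entry.
  Splitting off the direction \<open>E\<close> makes the larger space a product with a line, with 0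
  going to \<open>(0, 0)\<close>.\<close>

lemma local_homology_folded_space_insert:
  fixes K J :: "'n::finite set"
  assumes j: "j \<notin> J" "j \<notin> K"
  shows "relative_homology_group q (top_of_set (folded_space K (insert j J))) (folded_space K (insert j J) - {0})
     \<cong> relative_homology_group (q-1) (top_of_set (folded_space K J)) (folded_space K J - {0})"
proof -
  let ?X = "folded_space K (insert j J)" and ?Y = "folded_space K J"
  define E :: "real^'n^'n" where "E = (\<chi> a b. if a = j \<and> b = j then 1 else 0)"
  define f where "f M = (M - M$j$j *\<^sub>R E, M$j$j)" for M :: "real^'n^'n"
  define g where "g z = fst z + snd z *\<^sub>R E" for z :: "(real^'n^'n) \<times> real"
  have fold_upd: "folded K (\<chi> i. if i = j then t else w$i) = folded K (\<chi> i. if i = j then 0 else w$i) + t *\<^sub>R E" for w t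
    using j(2) by (auto simp: folded_def vec_eq_iff E_def)
  have Yj: "M$j$j = 0" if "M \<in> ?Y" for M
    using that j by (auto simp: folded_space_def folded_def)
  have gX: "g (M,t) \<in> ?X" if "M \<in> ?Y" for M t
  proof -
    obtain w :: "real^'n" where w: "M = folded K w" "\<forall>i. i \<notin> J \<longrightarrow> w$i = 0" using \<open>M \<in> ?Y\<close> unfolding folded_space_def by blast
    then have "(\<chi> i. if i = j then 0 else w$i) = w" using j by (auto simp: vec_eq_iff)
    then have "g (M,t) = folded K (\<chi> i. if i = j then t else w$i)"
      using fold_upd[of t w] w by (simp add: g_def)
    moreover have "folded K (\<chi> i. if i = j then t else w$i) \<in> ?X"
      unfolding folded_space_def using w(2) by (intro imageI) auto
    ultimately show ?thesis by simp
  qed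
  have fY: "M - M$j$j *\<^sub>R E \<in> ?Y" if "M \<in> ?X" for M
  proof -
    obtain w :: "real^'n" where w: "M = folded K w" "\<forall>i. i \<notin> insert j J \<longrightarrow> w$i = 0" using \<open>M \<in> ?X\<close> unfolding folded_space_def by blast
    have "(\<chi> i. if i = j then w$j else w$i) = w" by (auto simp: vec_eq_iff)
    moreover have "M$j$j = w$j" using w j by (simp add: folded_def)
    ultimately have "M - M$j$j *\<^sub>R E = folded K (\<chi> i. if i = j then 0 else w$i)"
      using fold_upd[of "w$j" w] w(1) by simp
    moreover have "folded K (\<chi> i. if i = j then 0 else w$i) \<in> ?Y"
      unfolding folded_space_def using w(2) by (intro imageI) auto
    ultimately show ?thesis by simp
  qed
  have Ejj: "E$j$j = 1" by (simp add: E_def)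
  have hm: "homeomorphic_maps (top_of_set ?X) (prod_topology (top_of_set ?Y) euclideanreal) f g"
  proof -
    have "continuous_on ?X f"
      unfolding f_def by (intro continuous_intros)
    moreover have "continuous_on (?Y \<times> UNIV) g"
      unfolding g_def by (intro continuous_intros)
    moreover have "prod_topology (top_of_set ?Y) euclideanreal = top_of_set (?Y \<times> UNIV)"
      by (simp add: prod_topology_subtopology)
    ultimately show ?thesis
      unfolding homeomorphic_maps_def
      using gX fY Yj by (auto simp: f_def g_def Ejj)
  qed
  then have hf: "homeomorphic_map (top_of_set ?X) (prod_topology (top_of_set ?Y) euclideanreal) f"
    using homeomorphic_maps_map by blast
  have "f ` (?X - {0}) = ?Y \<times> UNIV - {(0,0)}"
  proof -
    have "f ` ?X = ?Y \<times> UNIV"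
      using homeomorphic_imp_surjective_map[OF hf] by simp
    moreover have "inj_on f ?X"
      using homeomorphic_imp_injective_map[OF hf] by simp
    moreover have "f 0 = (0,0)" by (simp add: f_def zero_prod_def)
    ultimately show ?thesis
      by (simp add: inj_on_image_set_diff[of f ?X])
  qed
  then have "relative_homology_group q (top_of_set ?X) (?X - {0}) \<cong>
    relative_homology_group q (prod_topology (top_of_set ?Y) euclideanreal) (?Y \<times> UNIV - {(0,0)})"
    by (intro is_isoI[OF homeomorphic_map_relative_homology_iso[OF hf]]) auto
  also have "\<dots> \<cong> relative_homology_group (q-1) (top_of_set ?Y) (?Y - {0})"
    using local_homology_suspension[of 0 "top_of_set ?Y" q] by (simp add: closedin_closed_eq)
  finally show ?thesis .
qed

lemma local_homology_folded_space:
  fixes K :: "'n::finite set"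
  assumes "K \<inter> J = {}"
  shows "relative_homology_group (q + int (card J)) (top_of_set (folded_space K (K \<union> J))) (folded_space K (K \<union> J) - {0})
     \<cong> relative_homology_group q (top_of_set (folded_space K K)) (folded_space K K - {0})"
  using finite[of J] assms
proof (induction J)
  case empty
  then show ?case by (simp add: iso_refl)
next
  case (insert j J)
  have "relative_homology_group (q + int (card (insert j J))) (top_of_set (folded_space K (insert j (K \<union> J)))) (folded_space K (insert j (K \<union> J)) - {0})
     \<cong> relative_homology_group (q + int (card (insert j J)) - 1) (top_of_set (folded_space K (K \<union> J))) (folded_space K (K \<union> J) - {0})"
    by (rule local_homology_folded_space_insert) (use insert in auto)
  also have "q + int (card (insert j J)) - 1 = q + int (card J)"
    using insert by simp
  also have "relative_homology_group (q + int (card J)) (top_of_set (folded_space K (K \<union> J))) (folded_space K (K \<union> J) - {0})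
     \<cong> relative_homology_group q (top_of_set (folded_space K K)) (folded_space K K - {0})"
    using insert by simp
  finally show ?case by simp
qed

lemma local_homology_folded_space_UNIV:
  fixes K :: "'n::finite set"
  shows "relative_homology_group q (top_of_set (range (folded K))) (range (folded K) - {0})
     \<cong> relative_homology_group (q - int (card (- K))) (top_of_set (folded_space K K)) (folded_space K K - {0})"
  using local_homology_folded_space[of K "-K" "q - int (card (- K))"] by (simp add: folded_space_def)

text \<open>For empty \<open>K\<close> the map \<open>folded\<close> embeds the space as diagonal
  matrices, so repeated suspension reduces the claim to the homology of a point.\<close>

lemma trivial_local_homology_euclidean:
  fixes a :: "real^'n"
  assumes "q \<noteq> int CARD('n)"
  shows "trivial_group (relative_homology_group q euclidean (UNIV - {a}))"
proof -
  have s: "folded_space {} {} = {0::real^'n^'n}"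
  proof -
    have "{w::real^'n. \<forall>i. i \<notin> {} \<longrightarrow> w$i = 0} = {0}" by (auto simp: vec_eq_iff)
    then show ?thesis by (simp add: folded_space_def)
  qed
  have "trivial_group (relative_homology_group (q - int CARD('n)) (top_of_set {0::real^'n^'n}) ({0} - {0}))"
    using assms by (simp add: homology_dimension_axiom)
  then have 1: "trivial_group (relative_homology_group q (top_of_set (range (folded {}))) (range (folded {}) - {0 :: real^'n^'n}))"
    using isomorphic_group_triviality[OF local_homology_folded_space_UNIV[of q "{}::'n set"]] by (simp add: s)
  let ?f = "\<lambda>w. folded {} (w - a)"
  let ?g = "\<lambda>M::real^'n^'n. (\<chi> i. M$i$i) + a"
  have "homeomorphic_maps euclidean (top_of_set (range (folded {}))) ?f ?g"
    unfolding homeomorphic_maps_def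
  proof (intro conjI)
    have "continuous_on UNIV ?f"
      by (rule continuous_on_compose2[OF continuous_on_folded]) (auto intro!: continuous_intros)
    then show "continuous_map euclidean (top_of_set (range (folded {}))) ?f"
      by (auto simp: continuous_map_in_subtopology)
    show "continuous_map (top_of_set (range (folded {}))) euclidean ?g"
      by (auto intro!: continuous_intros)
    show "\<forall>x\<in>topspace euclidean. ?g (?f x) = x"
      by (simp add: folded_def vec_eq_iff)
    show "\<forall>y\<in>topspace (top_of_set (range (folded {}))). ?f (?g y) = y"
    proof
      fix M :: "real^'n^'n" assume "M \<in> topspace (top_of_set (range (folded {})))"
      then obtain w where "M = folded {} w" by auto
      then show "?f (?g M) = M" by (simp add: folded_def vec_eq_iff)
    qed
  qed
  then have hf: "homeomorphic_map euclidean (top_of_set (range (folded {}))) ?f"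
    using homeomorphic_maps_map by blast
  have "?f ` (UNIV - {a}) = range (folded {}) - {0}"
  proof -
    have "?f ` UNIV = range (folded {})"
      using homeomorphic_imp_surjective_map[OF hf] by simp
    moreover have "inj_on ?f UNIV"
      using homeomorphic_imp_injective_map[OF hf] by simp
    ultimately show ?thesis
      by (simp add: inj_on_image_set_diff[of ?f UNIV])
  qed
  then have "relative_homology_group q euclidean (UNIV - {a}) \<cong> relative_homology_group q (top_of_set (range (folded {}))) (range (folded {}) - {0 :: real^'n^'n})"
    by (intro is_isoI[OF homeomorphic_map_relative_homology_iso[OF hf]]) auto
  then show ?thesis using 1 by (simp add: isomorphic_group_triviality)
qed

text \<open>Where \<open>w$k\<close> is nonzero, row \<open>k\<close> of the matrix is
  \<open>w$k\<close> times \<open>w\<close>, and its diagonal entry is the square of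
  \<open>w$k\<close>. Dividing the row by either square root of that entry recovers \<open>w\<close>
  on one of the two sheets \<open>V 1\<close> and \<open>V (-1)\<close>.\<close>

lemma covering_space_folded:
  fixes K :: "'n::finite set"
  shows "covering_space ({w. \<forall>i. i \<notin> K \<longrightarrow> w$i = 0} - {0}) (folded K) (folded_space K K - {0})"
proof
  let ?E = "{w. \<forall>i. i \<notin> K \<longrightarrow> w$i = 0} - {0 :: real^'n}" and ?B = "folded_space K K - {0}"
  show "continuous_on ?E (folded K)" by (rule continuous_on_folded)
  have z: "folded K w = 0 \<longleftrightarrow> w = 0" for w
    using folded_eq_iff[of K w 0] by (auto simp: vec_eq_iff)
  show im: "folded K ` ?E = ?B"
    using z by (auto simp: folded_space_def)
  fix M assume "M \<in> ?B"
  then obtain w where w: "w \<in> ?E" "M = folded K w" using im by auto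
  then obtain k where "w$k \<noteq> 0" by (auto simp: vec_eq_iff)
  then have k: "w$k \<noteq> 0" "k \<in> K" using w(1) by auto
  have entry: "folded K v $ k $ i = v$k * v$i" if "v \<in> ?E" for v i
    using that k(2) by (auto simp: folded_def)
  define T where "T = {M \<in> ?B. M$k$k > 0}"
  define V where "V e = {v \<in> ?E. e * v$k > 0}" for e :: real
  have opT: "openin (top_of_set ?B) T"
  proof -
    have "T = ?B \<inter> {M. M$k$k > 0}" by (auto simp: T_def)
    moreover have "open {M :: real^'n^'n. M$k$k > 0}" by (intro open_Collect_less continuous_intros)
    ultimately show ?thesis by auto
  qed
  have opV: "openin (top_of_set ?E) (V e)" for e
  proof -
    have "V e = ?E \<inter> {v. e * v$k > 0}" by (auto simp: V_def)
    moreover have "open {v :: real^'n. e * v$k > 0}" by (intro open_Collect_less continuous_intros)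
    ultimately show ?thesis by auto
  qed
  have hom: "homeomorphism (V e) T (folded K) (\<lambda>M. \<chi> i. M$k$i / (e * sqrt (M$k$k)))" if e: "e = 1 \<or> e = -1" for e
  proof (rule homeomorphismI)
    show "continuous_on (V e) (folded K)" by (rule continuous_on_folded)
    show "continuous_on T (\<lambda>M. \<chi> i. M$k$i / (e * sqrt (M$k$k)))"
      using e by (auto simp: T_def intro!: continuous_intros continuous_on_vec_lambda)
    have vsqrt: "e * sqrt (v$k * v$k) = v$k" if "v \<in> V e" for v
      using that e by (auto simp: V_def real_sqrt_mult_self)
    show inv_left: "(\<chi> i. folded K v $ k $ i / (e * sqrt (folded K v $ k $ k))) = v" if "v \<in> V e" for v
    proof -
      have "v \<in> ?E" "v$k \<noteq> 0" using that by (auto simp: V_def)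
      then show ?thesis using vsqrt[OF that] by (simp add: entry vec_eq_iff)
    qed
    show sub: "folded K ` V e \<subseteq> T"
    proof safe
      fix v assume v: "v \<in> V e"
      then have "v \<in> ?E" "v$k \<noteq> 0" by (auto simp: V_def)
      then have "folded K v \<in> ?B" "folded K v $ k $ k > 0"
        using im entry[of v k] by (auto simp: zero_less_mult_iff)
      then show "folded K v \<in> T" by (simp add: T_def)
    qed
    have ex: "\<exists>v \<in> V e. M = folded K v" if "M \<in> T" for M
    proof -
      obtain v where v: "v \<in> ?E" "M = folded K v" using \<open>M \<in> T\<close> im unfolding T_def by blast
      then have "v$k * v$k > 0" using that entry[OF v(1), of k] by (simp add: T_def)
      then have "v$k \<noteq> 0" by auto
      then have "v \<in> V e \<or> - v \<in> V e" using v(1) e by (auto simp: V_def vec_eq_iff)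
      moreover have "folded K (- v) = folded K v" using v(1) by (auto simp: folded_eq_iff)
      ultimately show ?thesis using v by metis
    qed
    show "(\<lambda>M. \<chi> i. M$k$i / (e * sqrt (M$k$k))) ` T \<subseteq> V e"
      using ex inv_left by force
    show "folded K (\<chi> i. M$k$i / (e * sqrt (M$k$k))) = M" if "M \<in> T" for M
      using ex[OF that] inv_left by force
  qed
  have "\<Union>{V 1, V (-1)} = ?E \<inter> folded K -` T"
  proof -
    have "v \<in> V 1 \<union> V (-1) \<longleftrightarrow> folded K v \<in> T" if "v \<in> ?E" for v
    proof -
      have "folded K v \<in> ?B" using im that by blast
      then have "folded K v \<in> T \<longleftrightarrow> v$k * v$k > 0" using entry[OF that, of k] by (simp add: T_def)
      then show ?thesis using that by (auto simp: V_def zero_less_mult_iff)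
    qed
    then show ?thesis by (auto simp: V_def)
  qed
  moreover have "pairwise disjnt {V 1, V (-1)}"
    by (auto simp: pairwise_def disjnt_def V_def)
  moreover have "M \<in> T"
    using \<open>M \<in> ?B\<close> w k entry[OF w(1), of k] by (auto simp: T_def zero_less_mult_iff)
  ultimately show "\<exists>T. M \<in> T \<and> openin (top_of_set ?B) T \<and>
       (\<exists>v. \<Union> v = ?E \<inter> folded K -` T \<and> (\<forall>u\<in>v. openin (top_of_set ?E) u) \<and> pairwise disjnt v \<and>
            (\<forall>u\<in>v. \<exists>q. homeomorphism u T (folded K) q))"
    using opT opV hom[of 1, THEN exI[where P="homeomorphism (V 1) T (folded K)"]]
      hom[of "-1", THEN exI[where P="homeomorphism (V (-1)) T (folded K)"]]
    by (intro exI[of _ T] conjI exI[of _ "{V 1, V (-1)}"]) auto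
qed

text \<open>The space is a contractible cone with apex 0, so its second local homology is the first
  homology of the punctured cone, which has a connected double cover once \<open>K\<close> has two
  indices.\<close>

lemma nontrivial_local_homology_folded:
  fixes K :: "'n::finite set"
  assumes "2 \<le> card K"
  shows "\<not> trivial_group (relative_homology_group 2 (top_of_set (folded_space K K)) (folded_space K K - {0}))"
proof -
  let ?E = "{w. \<forall>i. i \<notin> K \<longrightarrow> w$i = 0} - {0 :: real^'n}" and ?B = "folded_space K K - {0}"
  obtain a b where ab: "a \<in> K" "b \<in> K" "a \<noteq> b"
    using assms card_le_Suc0_iff_eq[of K] by fastforce
  \<comment> \<open>The detour through \<open>axis b 1\<close> avoids the origin, which the segment
    between the two antipodal points contains.\<close>
  define \<gamma> where "\<gamma> = linepath (axis a 1) (axis b 1) +++ linepath (axis b 1) (- axis a (1::real) :: real^'n)"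
  have seg: "closed_segment (axis c s) (axis d t) \<subseteq> ?E" if "c \<in> K" "d \<in> K" "c \<noteq> d" "s \<noteq> 0" "t \<noteq> 0" for c d and s t :: real
  proof
    fix x :: "real^'n" assume "x \<in> closed_segment (axis c s) (axis d t)"
    then obtain u where x: "x = (1 - u) *\<^sub>R axis c s + u *\<^sub>R axis d t" by (auto simp: in_segment)
    then have "x$c = (1-u) * s" "x$d = u * t" using that by (auto simp: axis_def)
    then have "x$c \<noteq> 0 \<or> x$d \<noteq> 0" using that by auto
    moreover have "x$i = 0" if "i \<notin> K" for i using that \<open>c \<in> K\<close> \<open>d \<in> K\<close> by (auto simp: x axis_def)
    ultimately show "x \<in> ?E" by auto
  qed
  have "- axis a 1 = (axis a (-1) :: real^'n)" by (simp add: axis_def vec_eq_iff)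
  moreover have "closed_segment (axis a 1) (axis b 1) \<subseteq> ?E" "closed_segment (axis b 1) (axis a (-1)) \<subseteq> ?E"
    by (rule seg; use ab in simp)+
  ultimately have im: "path_image \<gamma> \<subseteq> ?E"
    unfolding \<gamma>_def by (intro subset_path_image_join) (simp_all only: path_image_linepath)
  have "\<not> trivial_group (homology_group 1 (top_of_set ?B))"
  proof (rule nontrivial_homology_group_1_if_double_cover[OF covering_space_folded[of K] _ _ _ _ im])
    show "pathfinish \<gamma> = - pathstart \<gamma>" "path \<gamma>" by (simp_all add: \<gamma>_def)
    show "- x \<in> ?E \<and> folded K (- x) = folded K x" if "x \<in> ?E" for x
      using that by (auto simp: folded_eq_iff)
    show "y = x \<or> y = - x" if "x \<in> ?E" "y \<in> ?E" "folded K x = folded K y" for x y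
    proof -
      have zero: "y$i = 0" "x$i = 0" if "i \<notin> K" for i
        using \<open>i \<notin> K\<close> \<open>x \<in> ?E\<close> \<open>y \<in> ?E\<close> by auto
      consider "\<forall>i\<in>K. x$i = y$i" | "\<forall>i\<in>K. x$i = - y$i"
        using \<open>folded K x = folded K y\<close> unfolding folded_eq_iff by blast
      then show ?thesis
      proof cases
        case 1
        then have "y$i = x$i" for i using zero[of i] by (cases "i \<in> K") auto
        then show ?thesis by (simp add: vec_eq_iff)
      next
        case 2
        then have "y$i = (- x)$i" for i using zero[of i] by (cases "i \<in> K") auto
        then show ?thesis by (simp add: vec_eq_iff)
      qed
    qed
    show "0 \<notin> ?E" by simp
  qed
  moreover have "relative_homology_group 2 (top_of_set (folded_space K K)) ?B \<cong> homology_group 1 (top_of_set ?B)"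
  proof -
    have "closed_segment 0 M \<subseteq> folded_space K K" if "M \<in> folded_space K K" for M
    proof
      fix N assume "N \<in> closed_segment 0 M"
      then obtain u where u: "0 \<le> u" "N = u *\<^sub>R M" by (auto simp: in_segment)
      obtain w where w: "\<forall>i. i \<notin> K \<longrightarrow> w$i = 0" "M = folded K w"
        using \<open>M \<in> folded_space K K\<close> unfolding folded_space_def by blast
      \<comment> \<open>On these vectors all entries of \<open>folded K\<close> are quadratic, hence
        the square root.\<close>
      then have "N = folded K (sqrt u *\<^sub>R w)"
        using u by (auto simp: folded_def vec_eq_iff)
      then show "N \<in> folded_space K K" using w(1) by (auto simp: folded_space_def)
    qed
    then have "starlike (folded_space K K)"
      unfolding starlike_def using zero_in_folded_space by blast
    then have "contractible_space (top_of_set (folded_space K K))"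
      by (simp add: starlike_imp_contractible)
    moreover have "topspace (top_of_set (folded_space K K)) \<inter> ?B \<noteq> {}"
    proof -
      have "pathstart \<gamma> \<in> ?E" using im by auto
      then have "folded K (pathstart \<gamma>) \<in> ?B"
        using covering_space_imp_surjective[OF covering_space_folded[of K]] by blast
      then show ?thesis by auto
    qed
    ultimately have "relative_homology_group 2 (top_of_set (folded_space K K)) ?B
        \<cong> reduced_homology_group (2-1) (subtopology (top_of_set (folded_space K K)) ?B)"
      by (rule isomorphic_group_relative_homology_of_contractible)
    moreover have "subtopology (top_of_set (folded_space K K)) ?B = top_of_set ?B"
      by (simp add: subtopology_subtopology Int_absorb1)
    ultimately show ?thesis by (simp add: un_reduced_homology_group)
  qed
  ultimately show ?thesis
    by (simp add: isomorphic_group_triviality)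
qed

section \<open>Local homology as an obstruction to Euclidean neighbourhoods\<close>

lemma local_homology_open_subset:
  assumes "openin X U" "p \<in> U" "closedin X {p}"
  shows "relative_homology_group q (subtopology X U) (U - {p}) \<cong> relative_homology_group q X (topspace X - {p})"
proof -
  have UX: "U \<subseteq> topspace X" by (rule openin_subset) fact
  have "X closure_of (topspace X - U) \<subseteq> X interior_of (topspace X - {p})"
  proof -
    have "X closure_of (topspace X - U) = topspace X - U"
      using assms(1) by (simp add: closure_of_closedin closedin_def openin_subset[of X U] double_diff)
    moreover have "X interior_of (topspace X - {p}) = topspace X - {p}"
      using assms(3) by (simp add: interior_of_openin openin_diff)
    ultimately show ?thesis using assms(2) by auto
  qed
  then have "hom_induced q (subtopology X (topspace X - (topspace X - U))) ((topspace X - {p}) - (topspace X - U))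
       (subtopology X (topspace X)) (topspace X - {p}) id
    \<in> iso (relative_homology_group q (subtopology X (topspace X - (topspace X - U))) ((topspace X - {p}) - (topspace X - U)))
        (relative_homology_group q (subtopology X (topspace X)) (topspace X - {p}))"
    by (rule homology_excision_axiom) auto
  moreover have "topspace X - (topspace X - U) = U" "(topspace X - {p}) - (topspace X - U) = U - {p}"
    using UX by auto
  ultimately show ?thesis by (auto simp: intro: is_isoI)
qed

lemma local_homology_homeomorphic:
  assumes "homeomorphic_map X Y f" "p \<in> topspace X"
  shows "relative_homology_group q X (topspace X - {p}) \<cong> relative_homology_group q Y (topspace Y - {f p})"
proof -
  have "f ` (topspace X - {p}) = topspace Y - {f p}"
    using homeomorphic_imp_surjective_map[OF assms(1)] homeomorphic_imp_injective_map[OF assms(1)] assms(2)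
    by (subst inj_on_image_set_diff[of f "topspace X"]) auto
  then show ?thesis
    by (intro is_isoI[OF homeomorphic_map_relative_homology_iso[OF assms(1)]]) auto
qed

proposition not_locally_euclidean_at_folded_point:
  fixes X :: "'a topology" and K :: "'n::finite set"
  assumes K: "3 \<le> card K" and p: "closedin X {p}"
    and U: "openin X U" "p \<in> U" "(subtopology X U) homeomorphic_space (euclidean :: (real^'n) topology)"
    and W: "openin X W" "p \<in> W" "homeomorphic_map (subtopology X W) (top_of_set V) h" "h p = 0"
    and V: "openin (top_of_set (range (folded K))) V"
  shows False
proof -
  \<comment> \<open>Each of the \<open>card (- K)\<close> line factors raises the degree by one
    above degree 2, where the cone has nonzero local homology. Equality with \<open>CARD('n)\<close>
    would mean \<open>card K = 2\<close>.\<close>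
  define q where "q = int (card (- K)) + 2"
  let ?F = "range (folded K) :: (real^'n^'n) set"
  have V0: "0 \<in> V" and VF: "V \<subseteq> ?F"
    using W homeomorphic_imp_surjective_map[OF W(3)] openin_subset[OF W(1)] openin_subset[OF V] by auto
  have "card K + card (-K) = CARD('n)"
    by (metis card_Un_disjoint Compl_disjoint Compl_partition finite)
  then have q: "q \<noteq> int CARD('n)" using K by (simp add: q_def)
  obtain f where f: "homeomorphic_map (subtopology X U) (euclidean :: (real^'n) topology) f"
    using U(3) by (auto simp: homeomorphic_space)
  let ?H = "relative_homology_group q"
  have tU: "topspace (subtopology X U) = U" and tW: "topspace (subtopology X W) = W"
    using openin_subset U(1) W(1) by (auto simp: Int_absorb1)
  have "trivial_group (?H (euclidean :: (real^'n) topology) (UNIV - {f p}))"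
    by (rule trivial_local_homology_euclidean[OF q])
  then have "trivial_group (?H (subtopology X U) (U - {p}))"
    using isomorphic_group_triviality[OF local_homology_homeomorphic[OF f, unfolded tU, OF U(2), of q]] by simp
  then have "trivial_group (?H X (topspace X - {p}))"
    using isomorphic_group_triviality[OF local_homology_open_subset[OF U(1,2) p, of q]] by simp
  then have "trivial_group (?H (subtopology X W) (W - {p}))"
    using isomorphic_group_triviality[OF local_homology_open_subset[OF W(1,2) p, of q]] by simp
  then have "trivial_group (?H (top_of_set V) (V - {0}))"
    using isomorphic_group_triviality[OF local_homology_homeomorphic[OF W(3), unfolded tW, OF W(2), of q]] W(4) by simp
  moreover have "subtopology (top_of_set ?F) V = top_of_set V"
    using VF by (simp add: subtopology_subtopology Int_absorb1)
  moreover have "closedin (top_of_set ?F) {0}"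
  proof -
    have "0 \<in> ?F" using V0 VF by blast
    then show ?thesis by (simp add: closedin_closed_eq)
  qed
  ultimately have "trivial_group (?H (top_of_set ?F) (?F - {0}))"
    using isomorphic_group_triviality[OF local_homology_open_subset[OF V V0, of q]] by simp
  then have "trivial_group (relative_homology_group 2 (top_of_set (folded_space K K)) (folded_space K K - {0}))"
    using isomorphic_group_triviality[OF local_homology_folded_space_UNIV[of q K]] by (simp add: q_def)
  then show False using nontrivial_local_homology_folded[of K] K by simp
qed

section \<open>The topology of seal spaces\<close>

text \<open>The pairing map of index \<open>i\<close> is multiplication by \<open>flip_sign A {i}\<close>, the vector of signs with exponents row \<open>i\<close> of
  \<open>A + I\<close>; the componentwise product of \<open>real^'n\<close> makes compositions of pairings products of such vectors.\<close>

definition flip_sign :: "bit^'n^'n \<Rightarrow> 'n::finite set \<Rightarrow> real^'n" where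
  "flip_sign A g = (\<chi> k. \<Prod>i\<in>g. if k = i \<or> A$i$k = 1 then -1 else 1)"

definition boundary_indices :: "real^'n \<Rightarrow> 'n set" where
  "boundary_indices x = {i. \<bar>x$i\<bar> = 1/4}"

definition seal_class :: "bit^'n^'n \<Rightarrow> real^'n \<Rightarrow> (real^'n) set" where
  "seal_class A x = {y. equivclp (seal_gen A) x y}"

lemma flip_sign_empty [simp]: "flip_sign A {} = 1"
  by (simp add: flip_sign_def vec_eq_iff)

lemma flip_sign_cases: "flip_sign A g $ k = 1 \<or> flip_sign A g $ k = -1"
proof -
  have "finite g" by simp
  then show ?thesis unfolding flip_sign_def vec_lambda_beta
    by (induction g rule: finite_induct) auto
qed

lemma abs_flip_sign [simp]: "\<bar>flip_sign A g $ k\<bar> = 1"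
  using flip_sign_cases[of A g k] by auto

lemma flip_sign_square [simp]: "flip_sign A g * flip_sign A g = 1"
proof -
  have "flip_sign A g $ k * flip_sign A g $ k = 1" for k
    using flip_sign_cases[of A g k] by auto
  then show ?thesis by (simp add: vec_eq_iff)
qed

lemma flip_sign_cancel [simp]: "flip_sign A g * (flip_sign A g * x) = x"
  by (simp flip: mult.assoc)

lemma flip_sign_Un_disjoint: "g \<inter> h = {} \<Longrightarrow> flip_sign A (g \<union> h) = flip_sign A g * flip_sign A h"
  by (simp add: flip_sign_def vec_eq_iff prod.union_disjoint)

text \<open>Common indices act twice and cancel, so subsets under symmetric difference describe all
  products of pairings.\<close>

lemma flip_sign_sym_diff: "flip_sign A (sym_diff g h) = flip_sign A g * flip_sign A h"
proof -
  have g: "flip_sign A g = flip_sign A (g - h) * flip_sign A (g \<inter> h)"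
    by (subst flip_sign_Un_disjoint[symmetric]) (auto simp: Diff_Int_distrib Un_Diff_Int)
  have h: "flip_sign A h = flip_sign A (h - g) * flip_sign A (g \<inter> h)"
    by (subst flip_sign_Un_disjoint[symmetric]) (auto simp: Un_Diff_Int Int_commute[of g h])
  have "flip_sign A g * flip_sign A h = flip_sign A (g - h) * flip_sign A (h - g) * (flip_sign A (g \<inter> h) * flip_sign A (g \<inter> h))"
    unfolding g h by (simp only: ac_simps)
  also have "\<dots> = flip_sign A (sym_diff g h)"
    by (subst flip_sign_Un_disjoint) auto
  finally show ?thesis ..
qed

lemma flip_sign_insert: "i \<notin> g \<Longrightarrow> flip_sign A (insert i g) = flip_sign A {i} * flip_sign A g"
  using flip_sign_Un_disjoint[of "{i}" g A] by simp

lemma seal_tau_eq: "seal_tau A i x = flip_sign A {i} * x"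
  by (simp add: seal_tau_def flip_sign_def vec_eq_iff)

lemma continuous_on_flip_sign: "continuous_on S (\<lambda>x. flip_sign A g * x)"
proof -
  have "continuous_on S (\<lambda>x. \<chi> k. flip_sign A g $ k * x $ k)"
    by (intro continuous_intros)
  then show ?thesis by (simp add: times_vec_def)
qed

lemma boundary_indices_flip [simp]: "boundary_indices (flip_sign A g * x) = boundary_indices x"
  by (simp add: boundary_indices_def abs_mult)

lemma seal_cube_iff: "x \<in> seal_cube \<longleftrightarrow> (\<forall>i. \<bar>x$i\<bar> \<le> 1/4)"
proof -
  have "(-(1/4) \<le> a \<and> a \<le> 1/4) = (\<bar>a\<bar> \<le> 1/4)" for a :: real by arith
  then show ?thesis unfolding seal_cube_def by simp
qed

lemma seal_cube_flip [simp]: "flip_sign A g * x \<in> seal_cube \<longleftrightarrow> x \<in> seal_cube"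
  by (simp add: seal_cube_iff abs_mult)

lemma seal_gen_iff: "seal_gen A x y \<longleftrightarrow> x \<in> seal_cube \<and> (\<exists>i\<in>boundary_indices x. y = flip_sign A {i} * x)"
  by (auto simp: seal_gen_def seal_tau_eq boundary_indices_def)

text \<open>Sign changes preserve absolute values, so a pairing available at \<open>x\<close> stays
  available after any others. The pairings are commuting involutions, which leaves only the subset
  of those applied.\<close>

lemma equivclp_seal_gen_iff:
  assumes x: "x \<in> seal_cube"
  shows "equivclp (seal_gen A) x y \<longleftrightarrow> (\<exists>g \<subseteq> boundary_indices x. y = flip_sign A g * x)"
proof
  assume "equivclp (seal_gen A) x y"
  then show "\<exists>g \<subseteq> boundary_indices x. y = flip_sign A g * x"
  proof (induction rule: equivclp_induct)
    case base
    then show ?case by (intro exI[of _ "{}"]) auto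
  next
    case (step y z)
    then obtain g where g: "g \<subseteq> boundary_indices x" "y = flip_sign A g * x" by auto
    from step(2) obtain i where i: "i \<in> boundary_indices x" "z = flip_sign A {i} * y"
    proof
      assume "seal_gen A y z"
      then show thesis using that g by (auto simp: seal_gen_iff)
    next
      assume "seal_gen A z y"
      then obtain i where i: "i \<in> boundary_indices z" "y = flip_sign A {i} * z" by (auto simp: seal_gen_iff)
      then have "i \<in> boundary_indices y" by simp
      then have "i \<in> boundary_indices x" using g by simp
      moreover have "z = flip_sign A {i} * y" using i by simp
      ultimately show thesis using that by blast
    qed
    have "z = flip_sign A (sym_diff {i} g) * x"
      unfolding flip_sign_sym_diff using i g by (simp add: mult.assoc)
    then show ?case using i g by (intro exI[of _ "sym_diff {i} g"]) auto
  qed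
next
  assume "\<exists>g \<subseteq> boundary_indices x. y = flip_sign A g * x"
  then obtain g where g: "g \<subseteq> boundary_indices x" "y = flip_sign A g * x" by auto
  have "equivclp (seal_gen A) x (flip_sign A g * x)"
    using finite[of g] g(1)
  proof (induction g rule: finite_induct)
    case empty
    then show ?case by simp
  next
    case (insert i g)
    have "flip_sign A (insert i g) * x = flip_sign A {i} * (flip_sign A g * x)"
      by (simp only: flip_sign_insert[OF insert.hyps(2)] mult.assoc)
    moreover have "i \<in> boundary_indices (flip_sign A g * x)" using insert.prems by simp
    moreover have "flip_sign A g * x \<in> seal_cube" using x by simp
    ultimately have "seal_gen A (flip_sign A g * x) (flip_sign A (insert i g) * x)"
      unfolding seal_gen_iff by blast
    then have 1: "equivclp (seal_gen A) (flip_sign A g * x) (flip_sign A (insert i g) * x)"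
      by (rule r_into_equivclp)
    have "equivclp (seal_gen A) x (flip_sign A g * x)" using insert.IH insert.prems by blast
    then show ?case by (rule equivclp_trans[OF _ 1])
  qed
  then show "equivclp (seal_gen A) x y" using g by simp
qed

lemma seal_class_eq_iff:
  assumes "x \<in> seal_cube"
  shows "seal_class A x = seal_class A y \<longleftrightarrow> (\<exists>g \<subseteq> boundary_indices x. y = flip_sign A g * x)"
proof -
  have "seal_class A x = seal_class A y \<longleftrightarrow> equivclp (seal_gen A) x y"
  proof
    assume "seal_class A x = seal_class A y"
    moreover have "y \<in> seal_class A y" by (simp add: seal_class_def)
    ultimately show "equivclp (seal_gen A) x y" by (simp add: seal_class_def set_eq_iff)
  next
    assume xy: "equivclp (seal_gen A) x y"
    have "equivclp (seal_gen A) x z \<longleftrightarrow> equivclp (seal_gen A) y z" for z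
      using equivclp_trans[OF xy] equivclp_trans[OF equivclp_sym[OF xy]] by blast
    then show "seal_class A x = seal_class A y" by (simp add: seal_class_def)
  qed
  then show ?thesis using equivclp_seal_gen_iff[OF assms] by simp
qed

lemma seal_points_eq: "seal_points A = seal_class A ` seal_cube"
  by (auto simp: seal_points_def seal_class_def)

text \<open>The points are equivalence classes, so the union of a set of points is its preimage
  under \<open>seal_class\<close>: the topology is the quotient topology.\<close>

lemma openin_seal_space:
  "openin (seal_space A) U \<longleftrightarrow> U \<subseteq> seal_points A \<and> openin (top_of_set seal_cube) {x \<in> seal_cube. seal_class A x \<in> U}"
proof -
  have Un: "\<Union>U = {x \<in> seal_cube. seal_class A x \<in> U}" if "U \<subseteq> seal_points A" for U
  proof (intro Set.set_eqI iffI)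
    fix x assume "x \<in> \<Union>U"
    then obtain y where y: "y \<in> seal_cube" "seal_class A y \<in> U" "x \<in> seal_class A y"
      using \<open>U \<subseteq> seal_points A\<close> by (auto simp: seal_points_eq)
    then obtain g where "g \<subseteq> boundary_indices y" "x = flip_sign A g * y"
      using equivclp_seal_gen_iff[of y A x] by (auto simp: seal_class_def)
    then show "x \<in> {x \<in> seal_cube. seal_class A x \<in> U}"
      using y seal_class_eq_iff[of y A x] by auto
  next
    fix x assume "x \<in> {x \<in> seal_cube. seal_class A x \<in> U}"
    then show "x \<in> \<Union>U" by (auto simp: seal_class_def intro!: bexI[of _ "{y. equivclp (seal_gen A) x y}"])
  qed
  have "istopology (\<lambda>U. U \<subseteq> seal_points A \<and> openin (top_of_set seal_cube) (\<Union>U))"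
    unfolding istopology_def
  proof (intro conjI allI impI)
    fix S T assume S: "S \<subseteq> seal_points A \<and> openin (top_of_set seal_cube) (\<Union>S)"
      and T: "T \<subseteq> seal_points A \<and> openin (top_of_set seal_cube) (\<Union>T)"
    then show "S \<inter> T \<subseteq> seal_points A" by auto
    then have "\<Union>(S \<inter> T) = \<Union>S \<inter> \<Union>T" using S T Un[of S] Un[of T] Un[of "S \<inter> T"] by auto
    then show "openin (top_of_set seal_cube) (\<Union>(S \<inter> T))" using S T by auto
  next
    fix K assume K: "\<forall>U\<in>K. U \<subseteq> seal_points A \<and> openin (top_of_set seal_cube) (\<Union>U)"
    then show "\<Union>K \<subseteq> seal_points A" by auto
    have "\<Union>(\<Union>K) = \<Union>((\<lambda>U. \<Union>U) ` K)" by auto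
    then show "openin (top_of_set seal_cube) (\<Union>(\<Union>K))" using K by auto
  qed
  then show ?thesis
    unfolding seal_space_def using Un by (simp add: topology_inverse' cong: conj_cong)
qed

lemma topspace_seal_space: "topspace (seal_space A) = seal_points A"
proof
  show "topspace (seal_space A) \<subseteq> seal_points A"
    by (meson openin_seal_space openin_topspace)
  have "openin (seal_space A) (seal_points A)"
    unfolding openin_seal_space seal_points_eq by (simp add: image_eqI cong: conj_cong)
  then show "seal_points A \<subseteq> topspace (seal_space A)" by (rule openin_subset)
qed

lemma quotient_map_seal_class: "quotient_map (top_of_set seal_cube) (seal_space A) (seal_class A)"
  unfolding quotient_map_def using openin_seal_space[of A]
  by (auto simp: topspace_seal_space seal_points_eq)

text \<open>The saturation of a closed set is a finite union of closed sets. The availability of a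
  pairing depends on the point, so \<open>C\<close> is first cut down to points with all coordinates
  in \<open>S\<close> on facets; there every \<open>g\<close> inside \<open>S\<close> may be
  applied.\<close>

lemma closed_map_seal_class:
  fixes A :: "bit^'n^'n"
  shows "closed_map (top_of_set seal_cube) (seal_space A) (seal_class A)"
  unfolding closed_map_def
proof (intro allI impI)
  fix C assume C: "closedin (top_of_set (seal_cube :: (real^'n) set)) C"
  then have CC: "C \<subseteq> seal_cube" by (rule closedin_imp_subset)
  define D where "D = (\<Union>S. \<Union>g\<in>Pow S. (\<lambda>x. flip_sign A g * x) ` (C \<inter> {x. \<forall>i\<in>S. \<bar>x$i\<bar> = 1/4}))"
  have D: "D = {x \<in> seal_cube. seal_class A x \<in> seal_class A ` C}"
  proof (intro Set.set_eqI iffI)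
    fix y assume "y \<in> D"
    then obtain S g x where x: "g \<subseteq> S" "x \<in> C" "\<forall>i\<in>S. \<bar>x$i\<bar> = 1/4" "y = flip_sign A g * x"
      by (auto simp: D_def)
    then have "g \<subseteq> boundary_indices x" by (auto simp: boundary_indices_def)
    moreover have "x \<in> seal_cube" using x CC by blast
    ultimately have "seal_class A x = seal_class A y" using seal_class_eq_iff x(4) by blast
    then show "y \<in> {x \<in> seal_cube. seal_class A x \<in> seal_class A ` C}"
      using x \<open>x \<in> seal_cube\<close> by (auto intro: image_eqI[where x=x])
  next
    fix y assume "y \<in> {x \<in> seal_cube. seal_class A x \<in> seal_class A ` C}"
    then obtain x where x: "x \<in> C" "seal_class A x = seal_class A y" by auto
    then obtain g where "g \<subseteq> boundary_indices x" "y = flip_sign A g * x"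
      using CC seal_class_eq_iff[of x A y] by auto
    then show "y \<in> D"
      unfolding D_def using x by (auto simp: boundary_indices_def intro!: exI[of _ "boundary_indices x"] bexI[of _ g])
  qed
  have "closed C"
  proof -
    have "closed (seal_cube :: (real^'n) set)"
      unfolding seal_cube_def
      by (intro closed_Collect_all closed_Collect_conj closed_Collect_le continuous_intros)
    then show ?thesis using C closedin_closed_trans by blast
  qed
  have "closed ((\<lambda>x. flip_sign A g * x) ` (C \<inter> {x. \<forall>i\<in>S. \<bar>x$i\<bar> = 1/4}))" for S g
  proof -
    have "(\<lambda>x. flip_sign A g * x) ` E = (\<lambda>x. flip_sign A g * x) -` E" for E
    proof (intro Set.set_eqI iffI)
      fix y assume "y \<in> (\<lambda>x. flip_sign A g * x) -` E"
      then have "y = flip_sign A g * (flip_sign A g * y)" "flip_sign A g * y \<in> E" by simp_all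
      then show "y \<in> (\<lambda>x. flip_sign A g * x) ` E" by (rule image_eqI)
    qed auto
    moreover have "closed (C \<inter> {x. \<forall>i\<in>S. \<bar>x$i\<bar> = 1/4})"
    proof -
      have "closed (\<Inter>i\<in>S. {x :: real^'n. \<bar>x$i\<bar> = 1/4})"
        by (intro closed_INT ballI closed_Collect_eq continuous_intros)
      moreover have "{x :: real^'n. \<forall>i\<in>S. \<bar>x$i\<bar> = 1/4} = (\<Inter>i\<in>S. {x. \<bar>x$i\<bar> = 1/4})" by auto
      ultimately show ?thesis using \<open>closed C\<close> by (simp only: closed_Int)
    qed
    ultimately show ?thesis using closed_vimage[OF _ continuous_on_flip_sign, of _ A g] by (simp only:)
  qed
  then have "closed D" unfolding D_def by (intro closed_UN ballI finite finite_Pow_iff[THEN iffD2])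
  then have "closedin (top_of_set seal_cube) D"
    using D by (intro closed_subset) auto
  then have "closedin (top_of_set seal_cube) {x \<in> topspace (top_of_set seal_cube). seal_class A x \<in> seal_class A ` C}"
    using D by simp
  moreover have "seal_class A ` C \<subseteq> topspace (seal_space A)"
    using CC by (auto simp: topspace_seal_space seal_points_eq)
  ultimately show "closedin (seal_space A) (seal_class A ` C)"
    using quotient_map_seal_class unfolding quotient_map_closedin by blast
qed

section \<open>Compactness, separation and countability of the seal space\<close>

lemma compact_seal_cube: "compact (seal_cube :: (real^'n) set)"
proof -
  have "seal_cube = cbox (\<chi> i. -(1/4)) (\<chi> i. 1/4 :: real^'n)"
    by (auto simp: seal_cube_def mem_box_cart)
  then show ?thesis by (metis compact_cbox)
qed

lemma compact_space_top_of_seal_cube: "compact_space (top_of_set (seal_cube :: (real^'n) set))"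
  by (simp add: compact_space_subtopology compact_seal_cube)

lemma continuous_map_seal_class: "continuous_map (top_of_set seal_cube) (seal_space A) (seal_class A)"
  by (rule quotient_imp_continuous_map[OF quotient_map_seal_class])

lemma compact_space_seal_space: "compact_space (seal_space A)"
  using image_compactin[OF compact_space_top_of_seal_cube[unfolded compact_space_def] continuous_map_seal_class, of A]
  by (simp add: compact_space_def topspace_seal_space seal_points_eq)

lemma Hausdorff_space_seal_space:
  fixes A :: "bit^'n^'n"
  shows "Hausdorff_space (seal_space A)"
proof -
  have "normal_space (top_of_set (seal_cube :: (real^'n) set))"
    by (simp add: metrizable_imp_normal_space metrizable_space_subtopology metrizable_space_euclidean)
  moreover have "Hausdorff_space (top_of_set (seal_cube :: (real^'n) set))"
    by (simp add: Hausdorff_space_subtopology)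
  ultimately show ?thesis
    using normal_Hausdorff_space_closed_continuous_map_image[OF _ _ closed_map_seal_class continuous_map_seal_class quotient_imp_surjective_map[OF quotient_map_seal_class]]
    by blast
qed

text \<open>A compact fibre over a point of \<open>U\<close> is covered by finitely many basic sets
  inside the preimage of \<open>U\<close>. The set \<open>W F\<close> of points whose whole fibre
  lies in \<open>\<Union>F\<close> is open because \<open>f\<close> is closed, and there are only
  countably many finite \<open>F\<close>.\<close>

lemma second_countable_compact_closed_map_image:
  assumes X: "second_countable X" "compact_space X" and Y: "t1_space Y"
    and f: "closed_map X Y f" "continuous_map X Y f" "f ` topspace X = topspace Y"
  shows "second_countable Y"
proof -
  obtain \<B> where \<B>: "countable \<B>" "\<And>V. V \<in> \<B> \<Longrightarrow> openin X V" "\<And>U x. openin X U \<Longrightarrow> x \<in> U \<Longrightarrow> \<exists>V \<in> \<B>. x \<in> V \<and> V \<subseteq> U"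
    using X(1) unfolding second_countable_def by metis
  define W where "W F = topspace Y - f ` (topspace X - \<Union>F)" for F
  have opW: "openin Y (W F)" if "F \<subseteq> \<B>" for F
  proof -
    have "openin X (\<Union>F)" using \<B>(2) that by blast
    then have "closedin Y (f ` (topspace X - \<Union>F))" using f(1) by (simp add: closed_map_def closedin_diff)
    then show ?thesis by (simp add: W_def openin_diff)
  qed
  show ?thesis
    unfolding second_countable_def
  proof (intro exI[of _ "W ` {F. finite F \<and> F \<subseteq> \<B>}"] conjI allI impI)
    show "countable (W ` {F. finite F \<and> F \<subseteq> \<B>})"
      using countable_Collect_finite_subset[OF \<B>(1)] by simp
    show "\<forall>V\<in>W ` {F. finite F \<and> F \<subseteq> \<B>}. openin Y V" using opW by auto
    fix U y assume U: "openin Y U \<and> y \<in> U"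
    then have y: "y \<in> topspace Y" by (meson openin_subset subsetD)
    let ?P = "{x \<in> topspace X. f x = y}"
    have "closedin X ?P"
      using closedin_continuous_map_preimage[OF f(2), of "{y}"] Y y by (simp add: closedin_t1_singleton)
    then have cP: "compactin X ?P" using X(2) closedin_compact_space by blast
    have opU: "openin X {x \<in> topspace X. f x \<in> U}"
      using openin_continuous_map_preimage[OF f(2)] U by simp
    define \<C> where "\<C> = {V \<in> \<B>. V \<subseteq> {x \<in> topspace X. f x \<in> U}}"
    have "?P \<subseteq> \<Union>\<C>"
    proof
      fix x assume "x \<in> ?P"
      then have "x \<in> {x \<in> topspace X. f x \<in> U}" using U by auto
      then show "x \<in> \<Union>\<C>" using \<B>(3)[OF opU] unfolding \<C>_def by blast
    qed
    moreover have "openin X V" if "V \<in> \<C>" for V using that \<B>(2) by (simp add: \<C>_def)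
    ultimately obtain F where F: "finite F" "F \<subseteq> \<C>" "?P \<subseteq> \<Union>F"
      using cP unfolding compactin_def by (elim conjE allE[of _ \<C>]) auto
    have "y \<in> W F" using F(3) y by (auto simp: W_def)
    moreover have "W F \<subseteq> U"
    proof
      fix z assume z: "z \<in> W F"
      then have "z \<in> f ` topspace X" using f(3) by (simp add: W_def)
      then obtain x where x: "x \<in> topspace X" "f x = z" by blast
      then have "x \<in> \<Union>F" using z by (auto simp: W_def)
      then show "z \<in> U" using F(2) x by (auto simp: \<C>_def)
    qed
    moreover have "F \<subseteq> \<B>" using F(2) by (auto simp: \<C>_def)
    ultimately show "\<exists>V\<in>W ` {F. finite F \<and> F \<subseteq> \<B>}. y \<in> V \<and> V \<subseteq> U"
      using F(1) by blast
  qed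
qed

lemma second_countable_seal_space:
  fixes A :: "bit^'n^'n"
  shows "second_countable (seal_space A)"
proof (rule second_countable_compact_closed_map_image[OF _ compact_space_top_of_seal_cube _ closed_map_seal_class continuous_map_seal_class])
  show "second_countable (top_of_set (seal_cube :: (real^'n) set))"
  proof (rule second_countable_subtopology)
    obtain B :: "(real^'n) set set" where B: "countable B" "topological_basis B"
      using ex_countable_basis by blast
    show "second_countable (euclidean :: (real^'n) topology)"
      unfolding second_countable_def
    proof (intro exI[of _ B] conjI ballI allI impI B(1))
      show "openin euclidean V" if "V \<in> B" for V
        using topological_basis_open[OF B(2) that] by simp
      fix U and x :: "real^'n" assume "openin euclidean U \<and> x \<in> U"
      then show "\<exists>V\<in>B. x \<in> V \<and> V \<subseteq> U"
        using topological_basisE[OF B(2), of U x] by (metis open_openin)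
    qed
  qed
  show "t1_space (seal_space A)"
    by (rule Hausdorff_imp_t1_space[OF Hausdorff_space_seal_space])
  show "seal_class A ` topspace (top_of_set seal_cube) = topspace (seal_space A)"
    by (rule quotient_imp_surjective_map[OF quotient_map_seal_class])
qed

section \<open>Local charts of seal spaces\<close>

text \<open>Displacements up to \<open>d\<close> keep the sign of every nonzero coordinate and do
  not bring a new coordinate to a facet. The bound 1/8 keeps the factor
  \<open>1 - 4 * \<bar>w$i\<bar>\<close> in \<open>displace\<close> positive.\<close>

definition chart_radius :: "real^'n \<Rightarrow> real \<Rightarrow> bool" where
  "chart_radius x d \<longleftrightarrow> 0 < d \<and> d \<le> 1/8 \<and> (\<forall>i. x$i \<noteq> 0 \<longrightarrow> d < \<bar>x$i\<bar>) \<and> (\<forall>i. \<bar>x$i\<bar> < 1/4 \<longrightarrow> d < 1/4 - \<bar>x$i\<bar>)"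

text \<open>The closed ball provides compactness in \<open>seal_chart_model\<close>; the open ball
  below provides an open image in the seal space.\<close>

definition sup_cball :: "real \<Rightarrow> (real^'n) set" where
  "sup_cball d = {w. \<forall>i. \<bar>w$i\<bar> \<le> d}"

definition sup_ball :: "real \<Rightarrow> (real^'n) set" where
  "sup_ball d = {w. \<forall>i. \<bar>w$i\<bar> < d}"

text \<open>For \<open>|x\<^sub>k| = 1/4\<close> the sign of \<open>w\<^sub>k\<close> does not enter \<open>displace\<close>, since \<open>x\<^sub>k\<close> can only move inwards. It decides in
  \<open>seal_chart\<close> whether the pairing of index \<open>k\<close> is applied, so crossing \<open>w\<^sub>k = 0\<close> means passing through a facet.\<close>

definition displace :: "real^'n \<Rightarrow> real^'n \<Rightarrow> real^'n" where
  "displace x w = (\<chi> k. if k \<in> boundary_indices x then x$k - 4 * x$k * \<bar>w$k\<bar> else x$k + w$k)"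

definition seal_chart :: "bit^'n^'n \<Rightarrow> real^'n \<Rightarrow> real^'n \<Rightarrow> (real^'n) set" where
  "seal_chart A x w = seal_class A (flip_sign A {i \<in> boundary_indices x. w$i < 0} * displace x w)"

lemma sup_ball_subset_cball: "sup_ball d \<subseteq> sup_cball d"
  by (auto simp: sup_ball_def sup_cball_def less_imp_le)

lemma ex_chart_radius:
  fixes x :: "real^'n"
  shows "\<exists>d. chart_radius x d"
proof -
  define R where "R = insert (1/8) ((\<lambda>i. if x$i \<noteq> 0 then \<bar>x$i\<bar> / 2 else 1) ` UNIV \<union> (\<lambda>i. if \<bar>x$i\<bar> < 1/4 then (1/4 - \<bar>x$i\<bar>) / 2 else 1) ` UNIV)"
  have R: "finite R" "R \<noteq> {}" by (auto simp: R_def)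
  have pos: "\<forall>r\<in>R. 0 < r" by (auto simp: R_def)
  have d: "0 < Min R" using R pos by simp
  have le: "Min R \<le> r" if "r \<in> R" for r using R(1) that by simp
  have "Min R \<le> 1/8" by (rule le) (simp add: R_def)
  moreover have "Min R < \<bar>x$i\<bar>" if "x$i \<noteq> 0" for i
  proof -
    have "\<bar>x$i\<bar> / 2 \<in> R" unfolding R_def using that by (auto intro!: image_eqI[where x=i])
    from le[OF this] show ?thesis using d that by linarith
  qed
  moreover have "Min R < 1/4 - \<bar>x$i\<bar>" if "\<bar>x$i\<bar> < 1/4" for i
  proof -
    have "(1/4 - \<bar>x$i\<bar>) / 2 \<in> R" unfolding R_def using that by (auto intro!: image_eqI[where x=i])
    from le[OF this] have "2 * Min R \<le> 1/4 - \<bar>x$i\<bar>" by simp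
    then show ?thesis using d by linarith
  qed
  ultimately show ?thesis using d unfolding chart_radius_def by blast
qed

lemma compact_sup_cball: "compact (sup_cball d :: (real^'n) set)"
proof -
  have "(\<bar>a\<bar> \<le> d) = (-d \<le> a \<and> a \<le> d)" for a :: real by arith
  then have "sup_cball d = cbox (\<chi> i. -d) (\<chi> i. d :: real^'n)"
    by (simp only: set_eq_iff sup_cball_def mem_box_cart mem_Collect_eq vec_lambda_beta simp_thms)
  then show ?thesis by (metis compact_cbox)
qed

lemma open_Collect_all_finite:
  fixes P :: "'i::finite \<Rightarrow> 'a::topological_space \<Rightarrow> bool"
  assumes "\<And>i. open {x. P i x}"
  shows "open {x. \<forall>i. P i x}"
  using open_INT[of UNIV "\<lambda>i. {x. P i x}"] assms by (simp add: INTER_eq)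

locale seal_chart_at =
  fixes A :: "bit^'n^'n" and x :: "real^'n" and d :: real
  assumes x: "x \<in> seal_cube" and d: "chart_radius x d"
begin

abbreviation "S \<equiv> boundary_indices x"

lemma d_pos: "0 < d" and d_le: "d \<le> 1/8" and d_nz: "x$i \<noteq> 0 \<Longrightarrow> d < \<bar>x$i\<bar>"
  using d by (auto simp: chart_radius_def)

lemma d_free: "i \<notin> S \<Longrightarrow> d < 1/4 - \<bar>x$i\<bar>"
  using d x unfolding chart_radius_def boundary_indices_def seal_cube_iff
  by (metis (mono_tags, lifting) mem_Collect_eq order_le_less)

lemma S_abs: "i \<in> S \<Longrightarrow> \<bar>x$i\<bar> = 1/4" by (simp add: boundary_indices_def)

lemma S_nz: "i \<in> S \<Longrightarrow> x$i \<noteq> 0" using S_abs by fastforce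

lemma displace_S: "i \<in> S \<Longrightarrow> displace x w $ i = x$i * (1 - 4 * \<bar>w$i\<bar>)"
  by (simp add: displace_def algebra_simps)

lemma displace_notS: "i \<notin> S \<Longrightarrow> displace x w $ i = x$i + w$i"
  by (simp add: displace_def)

lemma ball_bounds: assumes "w \<in> sup_cball d" shows "\<bar>w$i\<bar> \<le> d" "0 < 1 - 4 * \<bar>w$i\<bar>"
proof -
  show 1: "\<bar>w$i\<bar> \<le> d" using assms by (simp add: sup_cball_def)
  show "0 < 1 - 4 * \<bar>w$i\<bar>" using 1 d_le by linarith
qed

lemma abs_displace_S:
  assumes "w \<in> sup_cball d" "i \<in> S"
  shows "\<bar>displace x w $ i\<bar> = 1/4 - \<bar>w$i\<bar>"
proof -
  have "\<bar>displace x w $ i\<bar> = \<bar>x$i\<bar> * (1 - 4 * \<bar>w$i\<bar>)"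
    using ball_bounds(2)[OF assms(1), of i] by (simp add: displace_S[OF assms(2)] abs_mult)
  then show ?thesis unfolding S_abs[OF assms(2)] by (simp add: algebra_simps)
qed

lemma displace_in_cube:
  assumes w: "w \<in> sup_cball d"
  shows "displace x w \<in> seal_cube"
  unfolding seal_cube_iff
proof
  fix i show "\<bar>displace x w $ i\<bar> \<le> 1/4"
  proof (cases "i \<in> S")
    case True then show ?thesis using abs_displace_S[OF w True] by simp
  next
    case False then show ?thesis
      using ball_bounds[OF w, of i] d_free[OF False] unfolding displace_notS[OF False] by linarith
  qed
qed

lemma boundary_indices_displace:
  assumes w: "w \<in> sup_cball d"
  shows "boundary_indices (displace x w) = {i \<in> S. w$i = 0}"
proof -
  have "\<bar>displace x w $ i\<bar> = 1/4 \<longleftrightarrow> i \<in> S \<and> w$i = 0" for i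
  proof (cases "i \<in> S")
    case True then show ?thesis using abs_displace_S[OF w True] by simp
  next
    case False
    have "\<bar>displace x w $ i\<bar> < 1/4"
      using ball_bounds[OF w, of i] d_free[OF False] unfolding displace_notS[OF False] by linarith
    then show ?thesis using False by simp
  qed
  then show ?thesis by (simp add: boundary_indices_def)
qed

text \<open>If \<open>w$i = 0\<close> for some \<open>i\<close> in \<open>S\<close>, the displaced
  point lies on a facet of index \<open>i\<close>, so applying that pairing does not change the
  class. This makes the formulas on adjacent orthants agree.\<close>

lemma seal_chart_eq:
  assumes w: "w \<in> sup_cball d" and g: "{i \<in> S. w$i < 0} \<subseteq> g" "g \<subseteq> {i \<in> S. w$i \<le> 0}"
  shows "seal_chart A x w = seal_class A (flip_sign A g * displace x w)"
proof -
  let ?h = "{i \<in> S. w$i < 0}"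
  have "flip_sign A g * displace x w = flip_sign A (g - ?h) * (flip_sign A ?h * displace x w)"
  proof -
    have "(g - ?h) \<union> ?h = g" using g(1) by blast
    then show ?thesis using flip_sign_Un_disjoint[of "g - ?h" ?h A] by (simp add: Int_commute mult.assoc)
  qed
  moreover have "g - ?h \<subseteq> boundary_indices (flip_sign A ?h * displace x w)"
    using g(2) by (auto simp: boundary_indices_displace[OF w])
  moreover have "flip_sign A ?h * displace x w \<in> seal_cube"
    using displace_in_cube[OF w] by simp
  ultimately show ?thesis
    unfolding seal_chart_def using seal_class_eq_iff by blast
qed

lemma continuous_on_displace: "continuous_on T (displace x)"
  unfolding displace_def
proof (intro continuous_on_vec_lambda)
  fix k show "continuous_on T (\<lambda>w. if k \<in> S then x$k - 4 * x$k * \<bar>w$k\<bar> else x$k + w$k)"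
    by (cases "k \<in> S") (auto intro!: continuous_intros)
qed

text \<open>On each closed orthant \<open>T g\<close> in the coordinates of \<open>S\<close> a fixed
  sign vector can be used; the finitely many closed pieces are pasted.\<close>

lemma continuous_map_seal_chart: "continuous_map (top_of_set (sup_cball d)) (seal_space A) (seal_chart A x)"
proof -
  define T where "T g = {w \<in> sup_cball d. \<forall>i\<in>S. if i \<in> g then w$i \<le> 0 else 0 \<le> w$i}" for g
  let ?f = "\<lambda>g w. seal_class A (flip_sign A g * displace x w)"
  have eq: "seal_chart A x w = ?f g w" if "w \<in> T g" "g \<in> Pow S" for w g
  proof (rule seal_chart_eq)
    show "w \<in> sup_cball d" using that by (simp add: T_def)
    have *: "if i \<in> g then w$i \<le> 0 else 0 \<le> w$i" if "i \<in> S" for i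
      using \<open>w \<in> T g\<close> that by (simp add: T_def)
    show "{i \<in> S. w$i < 0} \<subseteq> g"
    proof
      fix i assume "i \<in> {i \<in> S. w$i < 0}"
      then show "i \<in> g" using *[of i] by (cases "i \<in> g") auto
    qed
    show "g \<subseteq> {i \<in> S. w$i \<le> 0}"
    proof
      fix i assume "i \<in> g"
      then show "i \<in> {i \<in> S. w$i \<le> 0}" using *[of i] \<open>g \<in> Pow S\<close> by auto
    qed
  qed
  show ?thesis
  proof (rule pasting_lemma_closed[where I = "Pow S" and T = T and f = ?f])
    show "finite (Pow S)" by simp
    show "closedin (top_of_set (sup_cball d)) (T g)" for g
    proof -
      have "closed {w :: real^'n. \<forall>i. i \<in> S \<longrightarrow> (if i \<in> g then w$i \<le> 0 else 0 \<le> w$i)}"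
      proof (intro closed_Collect_all)
        fix i show "closed {w :: real^'n. i \<in> S \<longrightarrow> (if i \<in> g then w$i \<le> 0 else 0 \<le> w$i)}"
          by (cases "i \<in> S"; cases "i \<in> g") (auto intro!: closed_Collect_le continuous_intros)
      qed
      moreover have "T g = sup_cball d \<inter> {w. \<forall>i. i \<in> S \<longrightarrow> (if i \<in> g then w$i \<le> 0 else 0 \<le> w$i)}"
        by (auto simp: T_def)
      ultimately show ?thesis by (simp only: closedin_closed_Int)
    qed
    show "continuous_map (subtopology (top_of_set (sup_cball d)) (T g)) (seal_space A) (?f g)" for g
    proof -
      have "continuous_on (sup_cball d) (\<lambda>w. flip_sign A g * displace x w)"
        by (rule continuous_on_compose2[OF continuous_on_flip_sign[of UNIV] continuous_on_displace]) auto
      then have "continuous_map (top_of_set (sup_cball d)) (top_of_set seal_cube) (\<lambda>w. flip_sign A g * displace x w)"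
        using displace_in_cube by (auto simp: continuous_map_in_subtopology)
      from continuous_map_compose[OF this continuous_map_seal_class[of A]]
      have "continuous_map (top_of_set (sup_cball d)) (seal_space A) (?f g)" by (simp only: o_def)
      then show ?thesis by (rule continuous_map_from_subtopology)
    qed
    show "?f g w = ?f h w" if "g \<in> Pow S" "h \<in> Pow S" "w \<in> topspace (top_of_set (sup_cball d)) \<inter> T g \<inter> T h" for g h w
      using eq[of w g] eq[of w h] that by simp
    show "\<exists>g. g \<in> Pow S \<and> w \<in> T g \<and> seal_chart A x w = ?f g w" if "w \<in> topspace (top_of_set (sup_cball d))" for w
    proof -
      have "w \<in> T {i \<in> S. w$i \<le> 0}" using that by (auto simp: T_def)
      moreover have "{i \<in> S. w$i \<le> 0} \<in> Pow S" by blast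
      ultimately show ?thesis using eq[of w "{i \<in> S. w$i \<le> 0}"] by blast
    qed
  qed
qed

text \<open>The sign change by \<open>g\<close> as seen in the chart: for \<open>k\<close> in
  \<open>S\<close> it exchanges the two sides of the facet if \<open>k\<close> is in
  \<open>g\<close>, while elsewhere the sign acts on the displacement itself.\<close>

definition act :: "'n set \<Rightarrow> real^'n \<Rightarrow> real^'n" where
  "act g w = (\<chi> k. if k \<in> S then (if k \<in> g then - w$k else w$k) else flip_sign A g $ k * w$k)"

text \<open>This is the group \<open>G\<close> of the overview. Coordinates with nonzero
  \<open>x$k\<close> cannot be negated, since nearby points share their sign.\<close>

definition isotropy :: "'n set set" where
  "isotropy = {g. g \<subseteq> S \<and> (\<forall>k. x$k \<noteq> 0 \<longrightarrow> flip_sign A g $ k = 1)}"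

text \<open>The total sign change \<open>G\<close> between the displaced points combines the
  crossings of \<open>w\<close> and \<open>w'\<close> with pairings \<open>t\<close> on facets
  containing the point. It is trivial wherever \<open>x\<close> is nonzero, because the radius
  excludes a change of sign there.\<close>

lemma seal_chart_eqD:
  assumes w: "w \<in> sup_cball d" and w': "w' \<in> sup_cball d" and eq: "seal_chart A x w = seal_chart A x w'"
  shows "\<exists>g \<in> isotropy. w' = act g w"
proof -
  let ?h = "{i \<in> S. w$i < 0}" and ?h' = "{i \<in> S. w'$i < 0}"
  have "flip_sign A ?h * displace x w \<in> seal_cube" using displace_in_cube[OF w] by simp
  then obtain t where t: "t \<subseteq> {i \<in> S. w$i = 0}" "flip_sign A ?h' * displace x w' = flip_sign A t * (flip_sign A ?h * displace x w)"
    using eq unfolding seal_chart_def by (auto simp: seal_class_eq_iff boundary_indices_displace[OF w])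
  define G where "G = flip_sign A ?h' * (flip_sign A t * flip_sign A ?h)"
  have "displace x w' = flip_sign A ?h' * (flip_sign A ?h' * displace x w')" by simp
  then have dw: "displace x w' = G * displace x w" unfolding t(2) G_def by (simp add: mult.assoc)
  have G: "G = flip_sign A (sym_diff ?h' (sym_diff t ?h))" by (simp add: G_def flip_sign_sym_diff)
  have absw: "\<bar>w'$k\<bar> = \<bar>w$k\<bar>" if "k \<in> S" for k
  proof -
    have "\<bar>displace x w' $ k\<bar> = \<bar>displace x w $ k\<bar>" unfolding dw by (simp add: G abs_mult)
    then show ?thesis using abs_displace_S[OF w that] abs_displace_S[OF w' that] by simp
  qed
  have G1: "G$k = 1" if "x$k \<noteq> 0" for k
  proof (rule ccontr)
    assume "G$k \<noteq> 1"
    then have "G$k = -1" using flip_sign_cases[of A _ k] by (auto simp: G)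
    then have neg: "displace x w' $ k = - displace x w $ k" by (simp add: dw)
    show False
    proof (cases "k \<in> S")
      case True
      have "x$k * (1 - 4 * \<bar>w'$k\<bar>) + x$k * (1 - 4 * \<bar>w$k\<bar>) = 0"
        using neg displace_S[OF True] by simp
      then have "x$k * ((1 - 4 * \<bar>w'$k\<bar>) + (1 - 4 * \<bar>w$k\<bar>)) = 0" by (simp only: distrib_left)
      then show False using that ball_bounds(2)[OF w, of k] ball_bounds(2)[OF w', of k] by simp
    next
      case False
      have "x$k + w'$k = - (x$k + w$k)" using neg displace_notS[OF False] by simp
      then show False using d_nz[OF that] ball_bounds(1)[OF w, of k] ball_bounds(1)[OF w', of k] by linarith
    qed
  qed
  \<comment> \<open>On \<open>t\<close> both displacements vanish, so membership in \<open>g\<close>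
    has no effect. On the rest of \<open>S\<close>, \<open>g\<close> records where \<open>w\<close>
    and \<open>w'\<close> lie on different sides of a facet.\<close>
  define g where "g = sym_diff ?h' (sym_diff t ?h)"
  have tw: "w$k = 0" "w'$k = 0" if "k \<in> t" for k
  proof -
    show "w$k = 0" using t that by auto
    moreover have "k \<in> S" using t that by auto
    ultimately show "w'$k = 0" using absw by fastforce
  qed
  have "w'$k = act g w $ k" for k
  proof (cases "k \<in> S")
    case True
    show ?thesis
    proof (cases "k \<in> t")
      case True then show ?thesis using tw[OF True] t(1) by (auto simp: act_def)
    next
      case False
      then have "k \<in> g \<longleftrightarrow> (w'$k < 0) \<noteq> (w$k < 0)" using True by (auto simp: g_def)
      then show ?thesis using absw[OF True] True by (auto simp: act_def abs_if split: if_splits)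
    qed
  next
    case False
    have "x$k + w'$k = G$k * (x$k + w$k)"
      using arg_cong[OF dw, of "\<lambda>v. v$k"] False by (simp add: displace_notS)
    then show ?thesis
      using G1[of k] False by (cases "x$k = 0") (auto simp: act_def G g_def)
  qed
  then have "w' = act g w" by (simp add: vec_eq_iff)
  moreover have "g \<in> isotropy" using G1 t(1) by (auto simp: isotropy_def g_def G)
  ultimately show ?thesis by blast
qed

lemma seal_chart_act:
  assumes w: "w \<in> sup_cball d" and g: "g \<in> isotropy"
  shows "act g w \<in> sup_cball d" "seal_chart A x (act g w) = seal_chart A x w"
proof -
  have gS: "g \<subseteq> S" and g1: "\<And>k. x$k \<noteq> 0 \<Longrightarrow> flip_sign A g $ k = 1" using g by (auto simp: isotropy_def)
  have absw: "\<bar>act g w $ k\<bar> = \<bar>w$k\<bar>" for k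
    by (simp add: act_def abs_mult)
  then show w': "act g w \<in> sup_cball d" using w by (simp add: sup_cball_def)
  have "displace x (act g w) $ k = (flip_sign A g * displace x w) $ k" for k
  proof (cases "k \<in> S")
    case True then show ?thesis using g1[OF S_nz[OF True]] absw by (simp add: displace_S)
  next
    case False then show ?thesis using g1[of k] by (cases "x$k = 0") (auto simp: displace_notS act_def)
  qed
  then have dis: "displace x (act g w) = flip_sign A g * displace x w" by (simp add: vec_eq_iff)
  let ?h = "{i \<in> S. w$i < 0}" and ?h' = "{i \<in> S. act g w $ i < 0}"
  \<comment> \<open>Negation by \<open>g\<close> changes the set of crossed facets except where
    \<open>w$k = 0\<close>. The pairings left over there act at facets containing the point and
    preserve its class.\<close>
  have "sym_diff ?h' g = sym_diff ?h {k \<in> g. w$k = 0}"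
    using gS by (auto simp: act_def)
  then have "flip_sign A ?h' * (flip_sign A g * displace x w) = flip_sign A (sym_diff ?h {k \<in> g. w$k = 0}) * displace x w"
    by (simp only: mult.assoc[symmetric] flip_sign_sym_diff[symmetric])
  also have "\<dots> = flip_sign A {k \<in> g. w$k = 0} * (flip_sign A ?h * displace x w)"
    by (simp only: flip_sign_sym_diff ac_simps)
  finally have "flip_sign A ?h' * displace x (act g w) = flip_sign A {k \<in> g. w$k = 0} * (flip_sign A ?h * displace x w)"
    by (simp only: dis)
  moreover have "{k \<in> g. w$k = 0} \<subseteq> boundary_indices (flip_sign A ?h * displace x w)"
    using gS by (auto simp: boundary_indices_displace[OF w])
  moreover have "flip_sign A ?h * displace x w \<in> seal_cube" using displace_in_cube[OF w] by simp
  ultimately have "seal_class A (flip_sign A ?h * displace x w) = seal_class A (flip_sign A ?h' * displace x (act g w))"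
    using seal_class_eq_iff by blast
  then show "seal_chart A x (act g w) = seal_chart A x w" by (simp add: seal_chart_def)
qed

lemma seal_chart_eq_iff:
  assumes "w \<in> sup_cball d" "w' \<in> sup_cball d"
  shows "seal_chart A x w = seal_chart A x w' \<longleftrightarrow> (\<exists>g \<in> isotropy. w' = act g w)"
  using seal_chart_eqD[OF assms] seal_chart_act[OF assms(1)] by metis

lemma seal_chart_zero: "seal_chart A x 0 = seal_class A x"
proof -
  have "displace x 0 = x" by (simp add: displace_def vec_eq_iff)
  then show ?thesis by (simp add: seal_chart_def)
qed

text \<open>Its preimage in the cube is the union of the sup-norm neighbourhoods of radius
  \<open>d\<close> around all points of the orbit of \<open>x\<close>.\<close>

lemma openin_seal_chart_image: "openin (seal_space A) (seal_chart A x ` sup_ball d)"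
proof -
  define V where "V g = {y \<in> seal_cube. \<forall>k. \<bar>y$k - flip_sign A g $ k * x$k\<bar> < d}" for g
  have opV: "openin (top_of_set seal_cube) (V g)" for g
  proof -
    have "open {y :: real^'n. \<forall>k. \<bar>y$k - flip_sign A g $ k * x$k\<bar> < d}"
      by (intro open_Collect_all_finite open_Collect_less continuous_intros)
    moreover have "V g = seal_cube \<inter> {y. \<forall>k. \<bar>y$k - flip_sign A g $ k * x$k\<bar> < d}" by (auto simp: V_def)
    ultimately show ?thesis by (simp only: openin_open_Int)
  qed
  have "{y \<in> seal_cube. seal_class A y \<in> seal_chart A x ` sup_ball d} = (\<Union>g\<in>Pow S. V g)"
  proof (intro Set.set_eqI iffI)
    fix y assume "y \<in> {y \<in> seal_cube. seal_class A y \<in> seal_chart A x ` sup_ball d}"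
    then obtain w where y: "y \<in> seal_cube" and w: "w \<in> sup_ball d" "seal_chart A x w = seal_class A y" by auto
    let ?h = "{i \<in> S. w$i < 0}"
    have wc: "w \<in> sup_cball d" using w sup_ball_subset_cball by blast
    have "flip_sign A ?h * displace x w \<in> seal_cube" using displace_in_cube[OF wc] by simp
    then obtain t where t: "t \<subseteq> {i \<in> S. w$i = 0}" "y = flip_sign A t * (flip_sign A ?h * displace x w)"
      using w(2) unfolding seal_chart_def by (auto simp: seal_class_eq_iff boundary_indices_displace[OF wc])
    have yk: "y = flip_sign A (sym_diff t ?h) * displace x w" by (simp only: t flip_sign_sym_diff mult.assoc)
    have "\<bar>y$k - flip_sign A (sym_diff t ?h) $ k * x$k\<bar> < d" for k
    proof -
      have "y$k - flip_sign A (sym_diff t ?h) $ k * x$k = flip_sign A (sym_diff t ?h) $ k * (displace x w $ k - x$k)"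
        unfolding yk by (simp add: right_diff_distrib)
      then have "\<bar>y$k - flip_sign A (sym_diff t ?h) $ k * x$k\<bar> = \<bar>displace x w $ k - x$k\<bar>" by (simp add: abs_mult)
      also have "\<dots> = \<bar>w$k\<bar>"
      proof (cases "k \<in> S")
        case True
        have "displace x w $ k - x$k = - (4 * x$k * \<bar>w$k\<bar>)" using True by (simp add: displace_def)
        then show ?thesis using S_abs[OF True] by (simp add: abs_mult)
      qed (simp add: displace_notS)
      finally show ?thesis using w by (simp add: sup_ball_def)
    qed
    then have "y \<in> V (sym_diff t ?h)" using y by (simp add: V_def)
    moreover have "sym_diff t ?h \<in> Pow S" using t(1) by auto
    ultimately show "y \<in> (\<Union>g\<in>Pow S. V g)" by blast
  next
    fix y assume "y \<in> (\<Union>g\<in>Pow S. V g)"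
    then obtain g where g: "g \<subseteq> S" and y: "y \<in> seal_cube" and yd: "\<And>k. \<bar>y$k - flip_sign A g $ k * x$k\<bar> < d"
      by (auto simp: V_def)
    define z where "z = flip_sign A g * y"
    have yz: "y = flip_sign A g * z" by (simp add: z_def)
    have zd: "\<bar>z$k - x$k\<bar> < d" for k
    proof -
      have "y$k - flip_sign A g $ k * x$k = flip_sign A g $ k * (z$k - x$k)"
        unfolding yz by (simp add: right_diff_distrib)
      then show ?thesis using yd[of k] by (simp add: abs_mult)
    qed
    have zc: "\<bar>z$k\<bar> \<le> 1/4" for k using y unfolding z_def seal_cube_iff by (simp add: abs_mult)
    \<comment> \<open>The inverse of the chart: in a coordinate of \<open>S\<close>, the distance to
      the facet, taken negative when \<open>g\<close> crosses it.\<close>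
    define w where "w = (\<chi> k. if k \<in> S then (if k \<in> g then - (1/4 - \<bar>z$k\<bar>) else 1/4 - \<bar>z$k\<bar>) else z$k - x$k)"
    have sgnz: "x$k * (4 * \<bar>z$k\<bar>) = z$k" "\<bar>1/4 - \<bar>z$k\<bar>\<bar> < d" if "k \<in> S" for k
    proof -
      consider "x$k = 1/4" | "x$k = - (1/4)" using S_abs[OF \<open>k \<in> S\<close>] by linarith
      then have "x$k * (4 * \<bar>z$k\<bar>) = z$k \<and> \<bar>1/4 - \<bar>z$k\<bar>\<bar> < d"
      proof cases
        case 1 then have "0 < z$k" using zd[of k] d_le by linarith
        then show ?thesis using 1 zd[of k] by auto
      next
        case 2 then have "z$k < 0" using zd[of k] d_le by linarith
        then show ?thesis using 2 zd[of k] by auto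
      qed
      then show "x$k * (4 * \<bar>z$k\<bar>) = z$k" "\<bar>1/4 - \<bar>z$k\<bar>\<bar> < d" by auto
    qed
    have w: "w \<in> sup_ball d"
    proof -
      have "\<bar>w$k\<bar> < d" for k
        using sgnz(2)[of k] zd[of k] by (cases "k \<in> S"; cases "k \<in> g") (auto simp: w_def)
      then show ?thesis by (simp add: sup_ball_def)
    qed
    have "displace x w $ k = z $ k" for k
    proof (cases "k \<in> S")
      case True
      have "\<bar>w$k\<bar> = 1/4 - \<bar>z$k\<bar>" using zc[of k] True by (simp add: w_def)
      then have "displace x w $ k = x$k * (4 * \<bar>z$k\<bar>)" using True by (simp add: displace_S)
      then show ?thesis using sgnz(1)[OF True] by simp
    qed (simp add: displace_notS w_def)
    then have "displace x w = z" by (simp add: vec_eq_iff)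
    moreover have "seal_chart A x w = seal_class A (flip_sign A {i \<in> g. w$i \<le> 0} * displace x w)"
    proof (rule seal_chart_eq)
      show "w \<in> sup_cball d" using w sup_ball_subset_cball by blast
      show "{i \<in> S. w$i < 0} \<subseteq> {i \<in> g. w$i \<le> 0}"
      proof
        fix i assume i: "i \<in> {i \<in> S. w$i < 0}"
        then have "i \<in> g" using zc[of i] by (auto simp: w_def split: if_splits)
        then show "i \<in> {i \<in> g. w$i \<le> 0}" using i by simp
      qed
    qed (use g in auto)
    moreover have "{i \<in> g. w$i \<le> 0} = g" using zc g by (auto simp: w_def)
    ultimately have "seal_class A y = seal_chart A x w" by (simp add: yz)
    then show "y \<in> {y \<in> seal_cube. seal_class A y \<in> seal_chart A x ` sup_ball d}"
      using y w by blast
  qed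
  moreover have "seal_chart A x ` sup_ball d \<subseteq> seal_points A"
  proof
    fix p assume "p \<in> seal_chart A x ` sup_ball d"
    then obtain w where w: "w \<in> sup_cball d" "p = seal_chart A x w" using sup_ball_subset_cball by blast
    have "flip_sign A {i \<in> S. w$i < 0} * displace x w \<in> seal_cube" using displace_in_cube[OF w(1)] by simp
    then show "p \<in> seal_points A" unfolding w(2) seal_chart_def seal_points_eq by (rule imageI)
  qed
  ultimately show ?thesis using opV by (auto simp: openin_seal_space)
qed

end

section \<open>Quotients by even sign changes\<close>

lemma continuous_on_Min_image:
  fixes f :: "'i \<Rightarrow> 'a::topological_space \<Rightarrow> 'b::linorder_topology"
  assumes "finite I" "I \<noteq> {}" "\<And>i. i \<in> I \<Longrightarrow> continuous_on T (f i)"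
  shows "continuous_on T (\<lambda>x. Min ((\<lambda>i. f i x) ` I))"
  using assms
proof (induction I rule: finite_ne_induct)
  case (insert i I)
  then have "continuous_on T (\<lambda>x. min (f i x) (Min ((\<lambda>i. f i x) ` I)))"
    by (intro continuous_on_min) auto
  then show ?case using insert by simp
qed simp

context
  fixes p :: "'n::finite \<Rightarrow> 'c"
begin

text \<open>\<open>block_fold\<close> realises the quotient of \<open>\<real>\<^sup>n\<close> by even sign changes in each fibre (block) of \<open>p\<close> as \<open>\<real>\<^sup>n\<close>. For one
  block this quotient is the orthant doubled along its boundary: the first copy is mapped identically, the second one
  is moved through the boundary of the orthant along the diagonal.\<close>

definition block_min :: "'n \<Rightarrow> real^'n \<Rightarrow> real" where
  "block_min k w = Min ((\<lambda>i. \<bar>w$i\<bar>) ` {i. p i = p k})"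

definition block_prod :: "'n \<Rightarrow> real^'n \<Rightarrow> real" where
  "block_prod k w = (\<Prod>i | p i = p k. w$i)"

definition block_fold :: "real^'n \<Rightarrow> real^'n" where
  "block_fold w = (\<chi> k. if block_prod k w \<le> 0 then \<bar>w$k\<bar> - 2 * block_min k w else \<bar>w$k\<bar>)"

lemma block_min_le: "p i = p k \<Longrightarrow> block_min k w \<le> \<bar>w$i\<bar>"
  by (simp add: block_min_def)

lemma block_min_attained: "\<exists>i. p i = p k \<and> block_min k w = \<bar>w$i\<bar>"
proof -
  have "block_min k w \<in> (\<lambda>i. \<bar>w$i\<bar>) ` {i. p i = p k}"
    unfolding block_min_def by (rule Min_in) auto
  then show ?thesis by auto
qed

lemma block_min_nonneg: "0 \<le> block_min k w"
  using block_min_attained[of k w] by auto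

lemma block_prod_eq_0_iff: "block_prod k w = 0 \<longleftrightarrow> block_min k w = 0"
proof
  assume "block_prod k w = 0"
  then obtain i where "p i = p k" "w$i = 0" by (auto simp: block_prod_def)
  then show "block_min k w = 0" using block_min_le[of i k w] block_min_nonneg[of k w] by simp
next
  assume "block_min k w = 0"
  then show "block_prod k w = 0" using block_min_attained[of k w] by (auto simp: block_prod_def)
qed

lemma block_cong: "p j = p k \<Longrightarrow> block_min j w = block_min k w" "p j = p k \<Longrightarrow> block_prod j w = block_prod k w"
  by (simp_all add: block_min_def block_prod_def)

text \<open>The two formulas agree where the block product vanishes, since some coordinate of the
  block, and with it the minimum, is zero there.\<close>

lemma continuous_on_block_fold: "continuous_on T block_fold"
  unfolding block_fold_def
proof (intro continuous_on_vec_lambda continuous_on_cases_le)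
  fix k
  have bm: "continuous_on U (block_min k)" for U
    unfolding block_min_def by (rule continuous_on_Min_image) (auto intro!: continuous_intros)
  show "continuous_on {w \<in> T. block_prod k w \<le> 0} (\<lambda>w. \<bar>w$k\<bar> - 2 * block_min k w)"
    by (intro continuous_intros bm)
  show "continuous_on T (block_prod k)"
    unfolding block_prod_def by (intro continuous_intros)
  show "\<bar>w$k\<bar> - 2 * block_min k w = \<bar>w$k\<bar>" if "block_prod k w = 0" for w
    using that by (simp add: block_prod_eq_0_iff)
qed (intro continuous_intros)

text \<open>Hence the image determines the absolute values and, off the zero set of \<open>block_prod\<close>, its sign.\<close>

lemma Min_block_fold:
  "Min ((\<lambda>i. block_fold w $ i) ` {i. p i = p k}) = (if block_prod k w \<le> 0 then - block_min k w else block_min k w)"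
proof (rule Min_eqI)
  obtain i where i: "p i = p k" "block_min k w = \<bar>w$i\<bar>" using block_min_attained by blast
  then have "block_fold w $ i = (if block_prod k w \<le> 0 then - block_min k w else block_min k w)"
    by (simp add: block_fold_def block_cong[OF i(1)])
  then show "(if block_prod k w \<le> 0 then - block_min k w else block_min k w) \<in> (\<lambda>i. block_fold w $ i) ` {i. p i = p k}"
    using i(1) by (intro image_eqI[where x=i]) auto
  fix y assume "y \<in> (\<lambda>i. block_fold w $ i) ` {i. p i = p k}"
  then obtain j where j: "p j = p k" "y = block_fold w $ j" by auto
  then show "(if block_prod k w \<le> 0 then - block_min k w else block_min k w) \<le> y"
    using block_min_le[OF j(1), of w] by (simp add: block_fold_def block_cong[OF j(1)])
qed simp

lemma block_fold_eqD:
  assumes "block_fold w = block_fold v"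
  shows "\<bar>w$k\<bar> = \<bar>v$k\<bar>" "block_prod k w \<le> 0 \<and> block_prod k v > 0 \<Longrightarrow> False"
proof -
  have m: "(if block_prod k w \<le> 0 then - block_min k w else block_min k w) = (if block_prod k v \<le> 0 then - block_min k v else block_min k v)"
    unfolding Min_block_fold[symmetric] assms ..
  have pos: "block_min k u > 0" if "block_prod k u > 0" for u
    using that block_prod_eq_0_iff[of k u] block_min_nonneg[of k u] by fastforce
  have z: "block_fold w $ k = block_fold v $ k" using assms by simp
  have iff: "block_prod k w \<le> 0 \<longleftrightarrow> block_prod k v \<le> 0"
    using m pos[of w] pos[of v] block_min_nonneg[of k w] block_min_nonneg[of k v] by (auto split: if_splits)
  then show "block_prod k w \<le> 0 \<and> block_prod k v > 0 \<Longrightarrow> False" by auto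
  show "\<bar>w$k\<bar> = \<bar>v$k\<bar>"
    using z iff m by (auto simp: block_fold_def split: if_splits)
qed

lemma block_prod_flip:
  "block_prod k (\<chi> i. if i \<in> g then - w$i else w$i) = (-1) ^ card {i \<in> g. p i = p k} * block_prod k w"
proof -
  have "block_prod k (\<chi> i. if i \<in> g then - w$i else w$i) = (\<Prod>i | p i = p k. (if i \<in> g then -1 else 1) * w$i)"
    unfolding block_prod_def by (intro prod.cong) auto
  also have "\<dots> = (\<Prod>i | p i = p k. if i \<in> g then -1 else 1) * block_prod k w"
    by (simp add: prod.distrib block_prod_def)
  also have "(\<Prod>i | p i = p k. if i \<in> g then -1 else 1 :: real) = (-1) ^ card {i \<in> g. p i = p k}"
    by (subst prod.If_cases) (auto simp: Int_def conj_commute)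
  finally show ?thesis .
qed

text \<open>The set \<open>D\<close> of changed coordinates can be odd in a block only if the block
  product is zero. The block then has a zero coordinate, which lies outside \<open>D\<close> and can
  be negated without effect to correct the parity.\<close>

lemma block_fold_eq_iff:
  "block_fold w = block_fold v \<longleftrightarrow>
    (\<exists>g. (\<forall>k. even (card {i \<in> g. p i = p k})) \<and> v = (\<chi> i. if i \<in> g then - w$i else w$i))"
proof
  assume eq: "block_fold w = block_fold v"
  have av: "\<bar>w$k\<bar> = \<bar>v$k\<bar>" for k by (rule block_fold_eqD(1)[OF eq])
  define D where "D = {i. v$i \<noteq> w$i}"
  have vD: "v = (\<chi> i. if i \<in> D then - w$i else w$i)"
  proof -
    have "v$i = (if i \<in> D then - w$i else w$i)" for i
      using av[of i] by (auto simp: D_def abs_if split: if_splits)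
    then show ?thesis by (simp add: vec_eq_iff)
  qed
  define odd_classes where "odd_classes = {c \<in> range p. odd (card {i \<in> D. p i = c})}"
  have "\<exists>i. p i = c \<and> w$i = 0" if "c \<in> odd_classes" for c
  proof -
    obtain k where k: "c = p k" "odd (card {i \<in> D. p i = p k})" using \<open>c \<in> odd_classes\<close> by (auto simp: odd_classes_def)
    have "block_prod k v = - block_prod k w" using block_prod_flip[of k D w] k(2) vD by simp
    then have "block_prod k w = 0"
      using block_fold_eqD(2)[OF eq, of k] block_fold_eqD(2)[OF eq[symmetric], of k]
      by (cases "block_prod k w" "0::real" rule: linorder_cases) auto
    then show ?thesis using k(1) by (auto simp: block_prod_def)
  qed
  then obtain e where e: "\<And>c. c \<in> odd_classes \<Longrightarrow> p (e c) = c \<and> w$(e c) = 0" by metis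
  define g where "g = D \<union> e ` odd_classes"
  have "even (card {i \<in> g. p i = p k})" for k
  proof (cases "p k \<in> odd_classes")
    case True
    have "{i \<in> g. p i = p k} = insert (e (p k)) {i \<in> D. p i = p k}"
      using e True by (auto simp: g_def)
    moreover have "e (p k) \<notin> D" using e[OF True] av[of "e (p k)"] by (auto simp: D_def)
    ultimately show ?thesis using True by (simp add: odd_classes_def)
  next
    case False
    then have "{i \<in> g. p i = p k} = {i \<in> D. p i = p k}" using e by (auto simp: g_def)
    then show ?thesis using False by (simp add: odd_classes_def)
  qed
  moreover have "v = (\<chi> i. if i \<in> g then - w$i else w$i)"
  proof -
    have "v$i = (if i \<in> g then - w$i else w$i)" for i
      using vD e av[of i] by (auto simp: g_def)
    then show ?thesis by (simp add: vec_eq_iff)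
  qed
  ultimately show "\<exists>g. (\<forall>k. even (card {i \<in> g. p i = p k})) \<and> v = (\<chi> i. if i \<in> g then - w$i else w$i)" by blast
next
  assume "\<exists>g. (\<forall>k. even (card {i \<in> g. p i = p k})) \<and> v = (\<chi> i. if i \<in> g then - w$i else w$i)"
  then obtain g where g: "\<And>k. even (card {i \<in> g. p i = p k})" "v = (\<chi> i. if i \<in> g then - w$i else w$i)" by blast
  have 1: "\<bar>v$k\<bar> = \<bar>w$k\<bar>" for k by (simp add: g(2))
  then have 2: "block_min k v = block_min k w" for k by (simp only: block_min_def)
  have 3: "block_prod k v = block_prod k w" for k using block_prod_flip[of k g w] g by simp
  show "block_fold w = block_fold v" by (simp only: block_fold_def 1 2 3)
qed

text \<open>If the block minimum \<open>m\<close> is nonnegative, \<open>z\<close> is its own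
  preimage there. Otherwise the diagonal shift by \<open>- 2 * m\<close> is undone and one
  coordinate \<open>e k\<close> is negated to select the second copy. The entries
  \<open>z$k - 2 * m k\<close> are less than three times the bound on \<open>z\<close>, hence
  \<open>d / 3\<close>.\<close>

lemma block_fold_surj:
  fixes z :: "real^'n"
  assumes z: "\<And>k. \<bar>z$k\<bar> < d / 3"
  shows "\<exists>w. (\<forall>k. \<bar>w$k\<bar> < d) \<and> block_fold w = z"
proof -
  define m where "m k = Min ((\<lambda>i. z$i) ` {i. p i = p k})" for k
  have m_le: "m k \<le> z$i" if "p i = p k" for i k using that by (simp add: m_def)
  have m_in: "\<exists>i. p i = p k \<and> m k = z$i" for k
  proof -
    have "m k \<in> (\<lambda>i. z$i) ` {i. p i = p k}" unfolding m_def by (rule Min_in) auto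
    then show ?thesis by auto
  qed
  have m_cong: "m i = m k" if "p i = p k" for i k using that by (simp add: m_def)
  define e where "e k = (SOME i. p i = p k)" for k
  have e: "p (e k) = p k" for k unfolding e_def by (rule someI[of _ k]) simp
  have e_cong: "e i = e k" if "p i = p k" for i k using that by (simp add: e_def)
  define w where "w = (\<chi> k. if 0 \<le> m k then z$k else if k = e k then - (z$k - 2 * m k) else z$k - 2 * m k)"
  have aw: "\<bar>w$k\<bar> = (if 0 \<le> m k then z$k else z$k - 2 * m k)" for k
    using m_le[of k k] by (auto simp: w_def)
  have "\<bar>w$k\<bar> < d" for k
  proof -
    obtain i where "m k = z$i" using m_in by blast
    then show ?thesis using z[of i] z[of k] unfolding aw by (auto split: if_splits)
  qed
  moreover have "block_fold w $ k = z $ k" for k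
  proof (cases "0 \<le> m k")
    case True
    have pos: "0 \<le> w$i" "\<bar>w$i\<bar> = z$i" if "p i = p k" for i
      using True m_cong[OF that] m_le[OF that] by (auto simp: w_def)
    have "0 \<le> block_prod k w" unfolding block_prod_def by (intro prod_nonneg) (use pos in auto)
    then show ?thesis
      using block_prod_eq_0_iff[of k w] pos(2)[of k] by (auto simp: block_fold_def)
  next
    case False
    have "block_min k w = - m k"
    proof -
      have "block_min k w = Min ((\<lambda>i. z$i - 2 * m k) ` {i. p i = p k})"
        unfolding block_min_def
      proof (intro arg_cong[where f=Min] image_cong refl)
        fix i assume "i \<in> {i. p i = p k}"
        then have "m i = m k" by (intro m_cong) simp
        then show "\<bar>w$i\<bar> = z$i - 2 * m k" using aw[of i] False by simp
      qed
      also have "\<dots> = - m k"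
      proof (rule Min_eqI)
        obtain i where "p i = p k" "m k = z$i" using m_in by blast
        then show "- m k \<in> (\<lambda>i. z$i - 2 * m k) ` {i. p i = p k}" by (intro image_eqI[where x=i]) auto
        fix y assume "y \<in> (\<lambda>i. z$i - 2 * m k) ` {i. p i = p k}"
        then obtain i where i: "y = z$i - 2 * m k" "i \<in> {i. p i = p k}" by (rule imageE)
        then have "p i = p k" by simp
        then show "- m k \<le> y" unfolding i(1) using m_le[of i k] by simp
      qed simp
      finally show ?thesis .
    qed
    moreover have "block_prod k w \<le> 0"
    proof -
      have "block_prod k w = w $ e k * (\<Prod>i\<in>{i. p i = p k} - {e k}. w$i)"
        unfolding block_prod_def by (subst prod.remove[of _ "e k"]) (auto simp: e)
      moreover have "w $ e k \<le> 0"
        using False m_cong[OF e, of k] e_cong[OF e, of k] m_le[OF e, of k] by (simp add: w_def)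
      moreover have "0 \<le> (\<Prod>i\<in>{i. p i = p k} - {e k}. w$i)"
      proof (rule prod_nonneg)
        fix i assume "i \<in> {i. p i = p k} - {e k}"
        then have i: "p i = p k" "i \<noteq> e i" using e_cong[of i k] by auto
        then show "0 \<le> w$i" using False m_cong[OF i(1)] m_le[OF i(1)] by (simp add: w_def)
      qed
      ultimately show ?thesis by (simp add: mult_nonpos_nonneg)
    qed
    ultimately show ?thesis using False by (simp add: block_fold_def aw)
  qed
  ultimately show ?thesis by (intro exI[of _ w]) (simp add: vec_eq_iff)
qed

end

section \<open>Seal spaces that are manifolds\<close>

text \<open>The parity condition says that \<open>g\<close> is a sum of pairs \<open>{i, j}\<close> with equal rows in \<open>A + I\<close>.\<close>

definition equal_row_parity :: "bit^'n^'n \<Rightarrow> 'n set \<Rightarrow> bool" where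
  "equal_row_parity A g \<longleftrightarrow> (\<forall>k. even (card {i \<in> g. \<forall>l. (l = i \<or> A$i$l = 1) = (l = k \<or> A$k$l = 1)}))"

lemma flip_sign_equal_row_parity:
  assumes "equal_row_parity A g"
  shows "flip_sign A g = 1"
proof -
  define r where "r i = {l. l = i \<or> A$i$l = 1}" for i
  have r: "(\<forall>l. (l = i \<or> A$i$l = 1) = (l = k \<or> A$k$l = 1)) \<longleftrightarrow> r i = r k" for i k
    by (auto simp: r_def)
  have "(\<Prod>i\<in>g. if k = i \<or> A$i$k = 1 then -1 else 1) = (1::real)" for k
  proof -
    have "(\<Prod>i\<in>g. if k = i \<or> A$i$k = 1 then -1 else 1) = (\<Prod>i\<in>g. if k \<in> r i then -1 else 1 :: real)"
      by (intro prod.cong) (auto simp: r_def)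
    also have "\<dots> = (\<Prod>c\<in>r ` g. \<Prod>i | i \<in> g \<and> r i = c. if k \<in> r i then -1 else 1)"
      by (rule prod.image_gen) simp
    also have "\<dots> = (\<Prod>c\<in>r ` g. 1)"
    proof (rule prod.cong)
      fix c assume "c \<in> r ` g"
      then obtain j where j: "c = r j" by auto
      have "(\<Prod>i | i \<in> g \<and> r i = c. if k \<in> r i then -1 else 1 :: real) = (\<Prod>i | i \<in> g \<and> r i = c. if k \<in> c then -1 else 1)"
        by (intro prod.cong) auto
      also have "\<dots> = (if k \<in> c then -1 else 1) ^ card {i \<in> g. r i = c}" by simp
      also have "\<dots> = 1" using assms unfolding equal_row_parity_def r j by auto
      finally show "(\<Prod>i | i \<in> g \<and> r i = c. if k \<in> r i then -1 else 1 :: real) = 1" .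
    qed simp
    finally show ?thesis by simp
  qed
  then show ?thesis by (simp add: flip_sign_def vec_eq_iff)
qed

context seal_chart_at
begin

text \<open>Continuous maps from a compact space to Hausdorff spaces are closed, so the chart and
  \<open>\<Psi>\<close> are quotient maps onto their images. Equal fibres let each factor through
  the other.\<close>

lemma seal_chart_model:
  fixes \<Psi> :: "real^'n \<Rightarrow> 'b::metric_space"
  assumes cont: "continuous_on (sup_cball d) \<Psi>"
    and fib: "\<And>w w'. \<lbrakk>w \<in> sup_cball d; w' \<in> sup_cball d\<rbrakk> \<Longrightarrow> \<Psi> w = \<Psi> w' \<longleftrightarrow> (\<exists>g\<in>isotropy. w' = act g w)"
    and V: "openin (top_of_set (\<Psi> ` sup_cball d)) V" "V \<subseteq> \<Psi> ` sup_ball d"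
  obtains U h where "openin (seal_space A) U" "homeomorphic_map (subtopology (seal_space A) U) (top_of_set V) h"
    "\<And>w. \<lbrakk>w \<in> sup_ball d; \<Psi> w \<in> V\<rbrakk> \<Longrightarrow> seal_chart A x w \<in> U \<and> h (seal_chart A x w) = \<Psi> w"
proof -
  let ?C = "top_of_set (sup_cball d :: (real^'n) set)" and ?c = "seal_chart A x"
  define Q where "Q = subtopology (seal_space A) (?c ` sup_cball d)"
  define M where "M = top_of_set (\<Psi> ` sup_cball d)"
  have cC: "compact_space ?C" by (simp add: compact_space_subtopology compact_sup_cball)
  have "?c ` sup_cball d \<subseteq> topspace (seal_space A)"
    using continuous_map_image_subset_topspace[OF continuous_map_seal_chart] by simp
  then have tQ: "topspace Q = ?c ` sup_cball d" by (auto simp: Q_def)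
  have cQ: "continuous_map ?C Q ?c"
    unfolding Q_def using continuous_map_seal_chart by (simp add: continuous_map_in_subtopology)
  have qQ: "quotient_map ?C Q ?c"
  proof (rule continuous_closed_imp_quotient_map[OF cQ])
    have "Hausdorff_space Q" unfolding Q_def by (intro Hausdorff_space_subtopology Hausdorff_space_seal_space)
    then show "closed_map ?C Q ?c" using cC cQ by (simp add: T1_Spaces.continuous_imp_closed_map)
  qed (simp add: tQ)
  have cM: "continuous_map ?C M \<Psi>"
    unfolding M_def using cont by (simp add: continuous_map_in_subtopology)
  have qM: "quotient_map ?C M \<Psi>"
  proof (rule continuous_closed_imp_quotient_map[OF cM])
    have "Hausdorff_space M" unfolding M_def by (intro Hausdorff_space_subtopology Hausdorff_space_euclidean)
    then show "closed_map ?C M \<Psi>" using cC cM by (simp add: T1_Spaces.continuous_imp_closed_map)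
  qed (simp add: M_def)
  have same: "?c w = ?c w' \<longleftrightarrow> \<Psi> w = \<Psi> w'" if "w \<in> topspace ?C" "w' \<in> topspace ?C" for w w'
    using that fib seal_chart_eq_iff by simp
  obtain h where h: "continuous_map Q M h" "\<And>w. w \<in> topspace ?C \<Longrightarrow> h (?c w) = \<Psi> w"
    using quotient_map_lift_exists[OF qQ cM] same by metis
  obtain k where k: "continuous_map M Q k" "\<And>w. w \<in> topspace ?C \<Longrightarrow> k (\<Psi> w) = ?c w"
    using quotient_map_lift_exists[OF qM cQ] same by metis
  have "homeomorphic_maps Q M h k"
    unfolding homeomorphic_maps_def using h k by (auto simp: tQ M_def)
  then have hm: "homeomorphic_map Q M h" using homeomorphic_maps_map by blast
  define U where "U = {p \<in> topspace Q. h p \<in> V}"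
  \<comment> \<open>\<open>U\<close> is a priori open only relative to the image of the closed ball.
    Lying in the image of the open ball, which is open, it is open in the seal space.\<close>
  have UO: "U \<subseteq> ?c ` sup_ball d"
  proof
    fix p assume "p \<in> U"
    then obtain w where w: "w \<in> sup_cball d" "p = ?c w" "\<Psi> w \<in> V" using h(2) by (auto simp: U_def tQ)
    then obtain v where v: "v \<in> sup_ball d" "\<Psi> w = \<Psi> v" using V(2) by blast
    then have "?c w = ?c v" using same[of w v] w(1) sup_ball_subset_cball by auto
    then show "p \<in> ?c ` sup_ball d" using v w by auto
  qed
  have "openin Q U"
    unfolding U_def by (rule openin_continuous_map_preimage[OF h(1)]) (use V(1) M_def in simp)
  then obtain T where T: "openin (seal_space A) T" "U = T \<inter> ?c ` sup_cball d"
    unfolding Q_def openin_subtopology by blast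
  have "U = T \<inter> ?c ` sup_ball d" using UO T(2) sup_ball_subset_cball by blast
  then have opU: "openin (seal_space A) U" using T(1) openin_seal_chart_image by auto
  have VM: "V \<subseteq> topspace M" using V(1) by (auto simp: M_def dest: openin_imp_subset)
  have "homeomorphic_map (subtopology Q U) (subtopology M V) h"
    by (rule homeomorphic_map_subtopologies_alt[OF hm]) (auto simp: U_def)
  moreover have "subtopology Q U = subtopology (seal_space A) U"
    unfolding Q_def using T(2) by (simp add: subtopology_subtopology Int_absorb1)
  moreover have "subtopology M V = top_of_set V"
    unfolding M_def using VM by (simp add: subtopology_subtopology M_def Int_absorb1)
  ultimately have "homeomorphic_map (subtopology (seal_space A) U) (top_of_set V) h" by simp
  moreover have "?c w \<in> U \<and> h (?c w) = \<Psi> w" if "w \<in> sup_ball d" "\<Psi> w \<in> V" for w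
  proof -
    have "w \<in> sup_cball d" using that(1) sup_ball_subset_cball by blast
    then show ?thesis using that(2) h(2)[of w] by (simp add: U_def tQ)
  qed
  ultimately show thesis using that opU by blast
qed

lemma locally_euclidean_seal_class:
  assumes iso: "\<And>g. \<forall>k\<in>g. flip_sign A g $ k = 1 \<Longrightarrow> equal_row_parity A g"
  shows "\<exists>U. openin (seal_space A) U \<and> seal_class A x \<in> U \<and>
      subtopology (seal_space A) U homeomorphic_space (euclidean :: (real^'n) topology)"
proof -
  \<comment> \<open>Blocks are the classes of equal rows inside \<open>S\<close>. An index outside
    \<open>S\<close> forms a block of its own, so evenness forbids its negation.\<close>
  define p where "p k = (if k \<in> S then Inl {l. l = k \<or> A$k$l = 1} else Inr k)" for k
  have par: "equal_row_parity A g \<longleftrightarrow> (\<forall>k. even (card {i \<in> g. p i = p k}))" if "g \<subseteq> S" for g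
  proof -
    have a: "{i \<in> g. p i = p k} = {i \<in> g. \<forall>l. (l = i \<or> A$i$l = 1) = (l = k \<or> A$k$l = 1)}" if "k \<in> S" for k
      using that \<open>g \<subseteq> S\<close> by (auto simp: p_def set_eq_iff)
    have b: "{i \<in> g. p i = p k} = {}" if "k \<notin> S" for k
      using that \<open>g \<subseteq> S\<close> by (auto simp: p_def)
    have c: "even (card {i \<in> g. \<forall>l. (l = i \<or> A$i$l = 1) = (l = k \<or> A$k$l = 1)})"
      if e: "\<And>k. k \<in> S \<Longrightarrow> even (card {i \<in> g. \<forall>l. (l = i \<or> A$i$l = 1) = (l = k \<or> A$k$l = 1)})" for k
    proof (cases "\<exists>j\<in>g. \<forall>l. (l = j \<or> A$j$l = 1) = (l = k \<or> A$k$l = 1)")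
      case True
      then obtain j where j: "j \<in> g" "\<forall>l. (l = j \<or> A$j$l = 1) = (l = k \<or> A$k$l = 1)" by blast
      then have "j \<in> S" using \<open>g \<subseteq> S\<close> by blast
      from e[OF this] show ?thesis unfolding j(2)[rule_format] .
    next
      case False
      then have "{i \<in> g. \<forall>l. (l = i \<or> A$i$l = 1) = (l = k \<or> A$k$l = 1)} = {}" by blast
      then show ?thesis by (simp only: card.empty even_zero)
    qed
    show ?thesis
    proof
      assume "equal_row_parity A g"
      then have e: "even (card {i \<in> g. \<forall>l. (l = i \<or> A$i$l = 1) = (l = k \<or> A$k$l = 1)})" for k
        unfolding equal_row_parity_def by blast
      show "\<forall>k. even (card {i \<in> g. p i = p k})"
      proof
        fix k show "even (card {i \<in> g. p i = p k})"
        proof (cases "k \<in> S")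
          case True show ?thesis unfolding a[OF True] by (rule e)
        next
          case False show ?thesis unfolding b[OF False] by simp
        qed
      qed
    next
      assume "\<forall>k. even (card {i \<in> g. p i = p k})"
      then have "even (card {i \<in> g. \<forall>l. (l = i \<or> A$i$l = 1) = (l = k \<or> A$k$l = 1)})" if "k \<in> S" for k
        unfolding a[OF that, symmetric] by blast
      then show "equal_row_parity A g" unfolding equal_row_parity_def using c by blast
    qed
  qed
  have isotropy_iff: "g \<in> isotropy \<longleftrightarrow> (\<forall>k. even (card {i \<in> g. p i = p k}))" for g
  proof
    assume g: "g \<in> isotropy"
    then have gS: "g \<subseteq> S" and "\<forall>k\<in>g. flip_sign A g $ k = 1" using S_nz by (auto simp: isotropy_def)
    then have "equal_row_parity A g" using iso by blast
    then show "\<forall>k. even (card {i \<in> g. p i = p k})" using par[OF gS] by blast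
  next
    assume ev: "\<forall>k. even (card {i \<in> g. p i = p k})"
    have gS: "g \<subseteq> S"
    proof (rule ccontr)
      assume "\<not> g \<subseteq> S"
      then obtain k where k: "k \<in> g" "k \<notin> S" by blast
      then have "{i \<in> g. p i = p k} = {k}" by (auto simp: p_def split: if_splits)
      then show False using ev[rule_format, of k] by simp
    qed
    then have "equal_row_parity A g" using par ev by blast
    then have "flip_sign A g = 1" by (rule flip_sign_equal_row_parity)
    then show "g \<in> isotropy" using gS by (simp add: isotropy_def)
  qed
  have act: "act g w = (\<chi> i. if i \<in> g then - w$i else w$i)" if "g \<in> isotropy" for g w
  proof -
    have gS: "g \<subseteq> S" using that by (simp add: isotropy_def)
    have "flip_sign A g = 1"
      using that gS par isotropy_iff flip_sign_equal_row_parity by blast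
    then show ?thesis using gS by (auto simp: act_def vec_eq_iff)
  qed
  have fib: "block_fold p w = block_fold p w' \<longleftrightarrow> (\<exists>g\<in>isotropy. w' = act g w)" for w w'
  proof -
    have "(\<exists>g\<in>isotropy. w' = act g w) \<longleftrightarrow> (\<exists>g\<in>isotropy. w' = (\<chi> i. if i \<in> g then - w$i else w$i))"
      using act by auto
    then show ?thesis unfolding block_fold_eq_iff using isotropy_iff by blast
  qed
  define V where "V = ball (0 :: real^'n) (d / 3)"
  have VB: "V \<subseteq> block_fold p ` sup_ball d"
  proof
    fix z assume "z \<in> V"
    then have "\<bar>z$k\<bar> < d / 3" for k
      using component_le_norm_cart[of z k] by (simp add: V_def)
    then obtain w where "\<forall>k. \<bar>w$k\<bar> < d" "block_fold p w = z" using block_fold_surj[of z d p] by blast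
    then show "z \<in> block_fold p ` sup_ball d" by (auto simp: sup_ball_def)
  qed
  have "openin (top_of_set (block_fold p ` sup_cball d)) V"
  proof -
    have "V = block_fold p ` sup_cball d \<inter> V" using VB sup_ball_subset_cball by blast
    moreover have "open V" by (simp add: V_def)
    ultimately show ?thesis by (metis openin_open_Int)
  qed
  then obtain U h where U: "openin (seal_space A) U" "homeomorphic_map (subtopology (seal_space A) U) (top_of_set V) h"
    "\<And>w. \<lbrakk>w \<in> sup_ball d; block_fold p w \<in> V\<rbrakk> \<Longrightarrow> seal_chart A x w \<in> U \<and> h (seal_chart A x w) = block_fold p w"
    using seal_chart_model[OF continuous_on_block_fold[of _ p] fib _ VB] by metis
  have "block_fold p 0 = 0"
  proof -
    have "block_min p k 0 = 0" for k using block_min_attained[of p k 0] by auto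
    then show ?thesis by (simp add: block_fold_def vec_eq_iff)
  qed
  then have "seal_chart A x 0 \<in> U" using U(3)[of 0] d_pos by (simp add: V_def sup_ball_def)
  moreover have "subtopology (seal_space A) U homeomorphic_space (euclidean :: (real^'n) topology)"
  proof -
    have "subtopology (seal_space A) U homeomorphic_space top_of_set V"
      using U(2) homeomorphic_map_imp_homeomorphic_space by blast
    also have "top_of_set V homeomorphic_space (euclidean :: (real^'n) topology)"
    proof -
      obtain f g where "homeomorphism V (UNIV :: (real^'n) set) f g"
        using homeomorphic_ball_UNIV[of "d/3" "0 :: real^'n"] d_pos unfolding V_def homeomorphic_def by auto
      then have "homeomorphic_maps (top_of_set V) euclidean f g"
        by (auto simp: homeomorphism_def homeomorphic_maps_def continuous_map_in_subtopology)
      then show ?thesis unfolding homeomorphic_space_def by blast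
    qed
    finally show ?thesis .
  qed
  ultimately show ?thesis using U(1) seal_chart_zero by metis
qed

end

proposition closed_manifold_seal_space:
  fixes A :: "bit^'n^'n"
  assumes "\<And>g. \<forall>k\<in>g. flip_sign A g $ k = 1 \<Longrightarrow> equal_row_parity A g"
  shows "closed_manifold (seal_space A) TYPE('n)"
  unfolding closed_manifold_def
proof (intro conjI ballI compact_space_seal_space Hausdorff_space_seal_space second_countable_seal_space)
  fix P assume "P \<in> topspace (seal_space A)"
  then obtain x where "x \<in> seal_cube" and P: "P = seal_class A x" by (auto simp: topspace_seal_space seal_points_eq)
  obtain d where "chart_radius x d" using ex_chart_radius by blast
  with \<open>x \<in> seal_cube\<close> interpret seal_chart_at A x d by unfold_locales
  show "\<exists>U. openin (seal_space A) U \<and> P \<in> U \<and> subtopology (seal_space A) U homeomorphic_space (euclidean :: (real^'n) topology)"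
    using locally_euclidean_seal_class[OF assms] unfolding P .
qed

section \<open>Seal spaces that are not manifolds\<close>

lemma equal_row_parity_empty: "equal_row_parity A {}"
  by (simp add: equal_row_parity_def)

lemma equal_row_parity_Un:
  assumes "equal_row_parity A g" "equal_row_parity A h" "g \<inter> h = {}"
  shows "equal_row_parity A (g \<union> h)"
  unfolding equal_row_parity_def
proof
  fix k
  let ?R = "\<lambda>i. \<forall>l. (l = i \<or> A$i$l = 1) = (l = k \<or> A$k$l = 1)"
  have "{i \<in> g \<union> h. ?R i} = {i \<in> g. ?R i} \<union> {i \<in> h. ?R i}" by blast
  moreover have "{i \<in> g. ?R i} \<inter> {i \<in> h. ?R i} = {}" using assms(3) by blast
  ultimately have "card {i \<in> g \<union> h. ?R i} = card {i \<in> g. ?R i} + card {i \<in> h. ?R i}"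
    by (simp add: card_Un_disjoint)
  then show "even (card {i \<in> g \<union> h. ?R i})" using assms(1,2) by (simp add: equal_row_parity_def)
qed

lemma equal_row_parity_pair:
  assumes "i \<noteq> j" "flip_sign A {i, j} = 1"
  shows "equal_row_parity A {i, j}"
proof -
  have same: "(l = i \<or> A$i$l = 1) = (l = j \<or> A$j$l = 1)" for l
  proof -
    have "flip_sign A {i, j} $ l = 1" using assms(2) by simp
    then show ?thesis using assms(1) by (auto simp: flip_sign_def split: if_splits)
  qed
  show ?thesis
    unfolding equal_row_parity_def
  proof
    fix k
    let ?R = "\<lambda>m. \<forall>l. (l = m \<or> A$m$l = 1) = (l = k \<or> A$k$l = 1)"
    have "?R i \<longleftrightarrow> ?R j" unfolding same ..
    then have "{m \<in> {i, j}. ?R m} = {i, j} \<or> {m \<in> {i, j}. ?R m} = {}" by blast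
    moreover have "even (card {i, j})" using assms(1) by simp
    ultimately show "even (card {m \<in> {i, j}. ?R m})" by (elim disjE) (simp_all only: card.empty even_zero)
  qed
qed

text \<open>The diagonal of \<open>folded K w\<close> carries the squares of the coordinates in
  \<open>K\<close> and the other coordinates themselves, so it alone decides membership in the
  ball.\<close>

lemma folded_sup_ball:
  fixes K :: "'n::finite set"
  assumes "0 < d"
  obtains T where "open T" "\<And>w. folded K w \<in> T \<longleftrightarrow> w \<in> sup_ball d"
proof
  let ?T = "{M :: real^'n^'n. \<forall>i. \<bar>M$i$i\<bar> < (if i \<in> K then d * d else d)}"
  show "open ?T" by (intro open_Collect_all_finite open_Collect_less continuous_intros)
  fix w :: "real^'n"
  have "\<bar>w$i * w$i\<bar> < d * d \<longleftrightarrow> \<bar>w$i\<bar> < d" for i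
  proof -
    have "\<bar>w$i * w$i\<bar> = \<bar>w$i\<bar>\<^sup>2" by (simp add: abs_mult power2_eq_square)
    moreover have "\<bar>w$i\<bar>\<^sup>2 < d\<^sup>2 \<longleftrightarrow> \<bar>w$i\<bar> < d"
      using assms power_mono_iff[of d "\<bar>w$i\<bar>" 2] by (simp add: not_le[symmetric])
    ultimately show ?thesis by (simp add: power2_eq_square)
  qed
  then have "\<bar>folded K w $ i $ i\<bar> < (if i \<in> K then d * d else d) \<longleftrightarrow> \<bar>w$i\<bar> < d" for i
    by (simp add: folded_def)
  then show "folded K w \<in> ?T \<longleftrightarrow> w \<in> sup_ball d" by (simp add: sup_ball_def)
qed

proposition not_closed_manifold_seal_space:
  fixes A :: "bit^'n^'n"
  assumes bad: "\<forall>k\<in>g0. flip_sign A g0 $ k = 1" "\<not> equal_row_parity A g0"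
  shows "\<not> closed_manifold (seal_space A) TYPE('n)"
proof
  assume man: "closed_manifold (seal_space A) TYPE('n)"
  \<comment> \<open>When \<open>g\<close> is disjoint from the support of its sign vector, this is
    the number of coordinates that \<open>g\<close> negates.\<close>
  define wt where "wt g = card g + card {k. flip_sign A g $ k = -1}" for g
  define P where "P g \<longleftrightarrow> (\<forall>k\<in>g. flip_sign A g $ k = 1) \<and> \<not> equal_row_parity A g" for g
  have "P g0" using bad by (simp add: P_def)
  then obtain g where Pg: "P g" and min: "\<And>h. P h \<Longrightarrow> wt g \<le> wt h"
    using ex_has_least_nat[of P g0 wt] by blast
  define Z where "Z = {k. flip_sign A g $ k = -1}"
  have gZ: "g \<inter> Z = {}" using Pg by (auto simp: P_def Z_def)
  have notZ: "flip_sign A g $ k = 1" if "k \<notin> Z" for k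
    using flip_sign_cases[of A g k] that by (auto simp: Z_def)
  define K where "K = g \<union> Z"
  \<comment> \<open>The value 1/4 makes exactly the pairings in \<open>g\<close> available, 0 allows
    exactly the coordinates in \<open>Z\<close> to be negated, and 1/8 blocks the remaining
    ones.\<close>
  define x :: "real^'n" where "x = (\<chi> k. if k \<in> g then 1/4 else if k \<in> Z then 0 else 1/8)"
  have xc: "x \<in> seal_cube" by (simp add: seal_cube_iff x_def)
  have S: "boundary_indices x = g" by (auto simp: boundary_indices_def x_def split: if_splits)
  obtain d where "chart_radius x d" using ex_chart_radius by blast
  with xc interpret seal_chart_at A x d by unfold_locales
  have xnz: "x$k \<noteq> 0 \<longleftrightarrow> k \<notin> Z" for k using gZ by (auto simp: x_def)
  have iso: "isotropy = {{}, g}"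
  proof
    show "{{}, g} \<subseteq> isotropy" using notZ by (auto simp: isotropy_def S xnz)
    show "isotropy \<subseteq> {{}, g}"
    proof (rule ccontr)
      assume "\<not> isotropy \<subseteq> {{}, g}"
      then obtain h where h: "h \<subseteq> g" "\<And>k. k \<notin> Z \<Longrightarrow> flip_sign A h $ k = 1" "h \<noteq> {}" "h \<noteq> g"
        by (auto simp: isotropy_def S xnz)
      \<comment> \<open>By minimality no proper subset of \<open>g\<close> in the isotropy group is
        a counterexample. Applied to \<open>h\<close> and \<open>g - h\<close>, this would give
        \<open>g\<close> even parity.\<close>
      have small: "equal_row_parity A f" if f: "f \<subseteq> g" "f \<noteq> g" "\<And>k. k \<notin> Z \<Longrightarrow> flip_sign A f $ k = 1" for f
      proof (rule ccontr)
        assume "\<not> equal_row_parity A f"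
        then have "P f" using f gZ by (auto simp: P_def)
        moreover have "wt f < wt g"
        proof -
          have "card f < card g" using f by (intro psubset_card_mono) auto
          moreover have "{k. flip_sign A f $ k = -1} \<subseteq> Z"
          proof
            fix k assume "k \<in> {k. flip_sign A f $ k = -1}"
            then show "k \<in> Z" using f(3)[of k] by (cases "k \<in> Z") auto
          qed
          then have "card {k. flip_sign A f $ k = -1} \<le> card Z" by (intro card_mono) auto
          ultimately show ?thesis by (simp add: wt_def Z_def)
        qed
        ultimately show False using min by fastforce
      qed
      have "flip_sign A (g - h) $ k = 1" if "k \<notin> Z" for k
      proof -
        have "sym_diff g h = g - h" using h(1) by blast
        then have "flip_sign A (g - h) = flip_sign A g * flip_sign A h" using flip_sign_sym_diff[of A g h] by simp
        then show ?thesis using notZ[OF that] h(2)[OF that] by simp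
      qed
      then have "equal_row_parity A (g - h)" using h by (intro small) auto
      moreover have "equal_row_parity A h" using h by (intro small) auto
      ultimately have "equal_row_parity A ((g - h) \<union> h)" by (intro equal_row_parity_Un) auto
      moreover have "(g - h) \<union> h = g" using h(1) by blast
      ultimately show False using Pg by (simp add: P_def)
    qed
  qed
  \<comment> \<open>A single index negates its own coordinate, which \<open>P\<close> excludes. A
    pair with empty \<open>Z\<close> consists of equal rows and is no counterexample.\<close>
  have "3 \<le> card K"
  proof (rule ccontr)
    assume "\<not> 3 \<le> card K"
    moreover have "card K = card g + card Z" unfolding K_def using gZ by (simp add: card_Un_disjoint)
    ultimately have le: "card g + card Z \<le> 2" by simp
    have "g \<noteq> {}" using Pg equal_row_parity_empty by (auto simp: P_def)
    moreover have "card g \<noteq> 1"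
    proof
      assume "card g = 1"
      then obtain i where "g = {i}" by (auto simp: card_1_singleton_iff)
      then show False using Pg by (simp add: P_def flip_sign_def)
    qed
    ultimately have "card g \<noteq> 0" "card g \<noteq> 1" by auto
    then have "card g = 2" "card Z = 0" using le by linarith+
    then obtain i j where ij: "g = {i, j}" "i \<noteq> j" and "Z = {}" by (auto simp: card_2_iff)
    then have "flip_sign A g = 1" using notZ by (simp add: vec_eq_iff)
    then show False using Pg equal_row_parity_pair[of i j A] ij by (simp add: P_def)
  qed
  have fib: "folded K w = folded K w' \<longleftrightarrow> (\<exists>g\<in>isotropy. w' = act g w)" for w w'
  proof -
    have "act {} w = w" by (simp add: act_def vec_eq_iff)
    moreover have "act g w = (\<chi> k. if k \<in> K then - w$k else w$k)"
    proof -
      have "act g w $ k = (if k \<in> K then - w$k else w$k)" for k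
      proof (cases "k \<in> Z")
        case True
        then have "flip_sign A g $ k = -1" by (simp add: Z_def)
        then show ?thesis using True gZ by (auto simp: act_def S K_def)
      next
        case False then show ?thesis using notZ[OF False] by (simp add: act_def S K_def)
      qed
      then show ?thesis by (simp add: vec_eq_iff)
    qed
    ultimately have "(\<exists>g\<in>isotropy. w' = act g w) \<longleftrightarrow> w' = w \<or> w' = (\<chi> k. if k \<in> K then - w$k else w$k)"
      by (simp add: iso)
    also have "\<dots> \<longleftrightarrow> (\<forall>i. w'$i = w$i) \<or> (\<forall>i. w'$i = (if i \<in> K then - w$i else w$i))"
      by (simp add: vec_eq_iff)
    also have "\<dots> \<longleftrightarrow> folded K w' = folded K w"
      unfolding folded_eq_iff by (auto split: if_splits)
    finally show ?thesis by auto
  qed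
  obtain T where T: "open T" "\<And>w. folded K w \<in> T \<longleftrightarrow> w \<in> sup_ball d"
    using folded_sup_ball[OF d_pos] by blast
  define V where "V = folded K ` sup_ball d"
  have VT: "V = folded K ` E \<inter> T" if "sup_ball d \<subseteq> E" for E
    unfolding V_def using T(2) that by blast
  have V1: "openin (top_of_set (folded K ` sup_cball d)) V"
    unfolding VT[OF sup_ball_subset_cball] using T(1) by (rule openin_open_Int)
  have V2: "openin (top_of_set (range (folded K))) V"
    unfolding VT[OF subset_UNIV] using T(1) by (rule openin_open_Int)
  obtain U h where U: "openin (seal_space A) U" "homeomorphic_map (subtopology (seal_space A) U) (top_of_set V) h"
    "\<And>w. \<lbrakk>w \<in> sup_ball d; folded K w \<in> V\<rbrakk> \<Longrightarrow> seal_chart A x w \<in> U \<and> h (seal_chart A x w) = folded K w"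
    using seal_chart_model[OF continuous_on_folded[of _ K] fib V1] unfolding V_def by blast
  have "(0::real^'n) \<in> sup_ball d" using d_pos by (simp add: sup_ball_def)
  then have p: "seal_class A x \<in> U" "h (seal_class A x) = 0"
    using U(3)[of 0] image_eqI[where f="folded K" and x=0 and A="sup_ball d"] by (simp_all add: V_def seal_chart_zero)
  have pX: "seal_class A x \<in> topspace (seal_space A)" using p(1) U(1) openin_subset by blast
  have "closedin (seal_space A) {seal_class A x}"
    using Hausdorff_imp_t1_space[OF Hausdorff_space_seal_space[of A]] pX by (simp add: closedin_t1_singleton)
  moreover obtain U' where "openin (seal_space A) U'" "seal_class A x \<in> U'"
     "subtopology (seal_space A) U' homeomorphic_space (euclidean :: (real^'n) topology)"
    using man pX unfolding closed_manifold_def by blast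
  ultimately show False
    using not_locally_euclidean_at_folded_point[OF \<open>3 \<le> card K\<close> _ _ _ _ U(1) p(1) U(2) p(2) V2] by blast
qed

section \<open>The rank conditions\<close>

definition row_sum :: "'a::comm_ring_1^'n^'m \<Rightarrow> 'm::finite set \<Rightarrow> 'a^'n" where
  "row_sum B g = (\<Sum>i\<in>g. row i B)"

lemma row_sum_component: "row_sum B g $ k = (\<Sum>i\<in>g. B$i$k)"
  by (simp add: row_sum_def row_def)

lemma bit_add_self: "x + x = (0::bit)"
  by (cases x) simp_all

lemma row_sum_sym_diff:
  fixes B :: "bit^'n^'m::finite"
  shows "row_sum B (sym_diff g h) = row_sum B g + row_sum B h"
proof -
  have g: "row_sum B g = row_sum B (g - h) + row_sum B (g \<inter> h)"
    unfolding row_sum_def by (subst sum.union_disjoint[symmetric]) (auto simp: Un_Diff_Int)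
  have h: "row_sum B h = row_sum B (h - g) + row_sum B (g \<inter> h)"
    unfolding row_sum_def by (subst sum.union_disjoint[symmetric]) (auto simp: Un_Diff_Int Int_commute[of g h])
  have "row_sum B (g \<inter> h) + row_sum B (g \<inter> h) = 0"
    by (simp add: vec_eq_iff bit_add_self)
  then have "row_sum B g + row_sum B h = row_sum B (g - h) + row_sum B (h - g)"
    unfolding g h by (metis (no_types, lifting) add.assoc add.commute add.right_neutral)
  also have "\<dots> = row_sum B (sym_diff g h)"
    unfolding row_sum_def by (subst sum.union_disjoint) auto
  finally show ?thesis ..
qed

text \<open>The only scalars are 0 and 1, so linear combinations are subset sums, and zero rows can
  be left out.\<close>

lemma span_rows_bit:
  fixes B :: "bit^'n^'m::finite"
  assumes "\<And>i. i \<notin> S \<Longrightarrow> row i B = 0"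
  shows "vec.span (rows B) = row_sum B ` Pow S"
proof
  have "vec.subspace (row_sum B ` Pow S)"
  proof (rule vec.subspaceI)
    show "0 \<in> row_sum B ` Pow S" by (rule image_eqI[where x="{}"]) (auto simp: row_sum_def)
    fix v w assume "v \<in> row_sum B ` Pow S" "w \<in> row_sum B ` Pow S"
    then obtain g h where "g \<subseteq> S" "h \<subseteq> S" "v = row_sum B g" "w = row_sum B h" by auto
    then show "v + w \<in> row_sum B ` Pow S"
      by (intro image_eqI[where x="sym_diff g h"]) (auto simp: row_sum_sym_diff)
  next
    fix c and v :: "bit^'n" assume v: "v \<in> row_sum B ` Pow S"
    have "0 \<in> row_sum B ` Pow S" by (rule image_eqI[where x="{}"]) (auto simp: row_sum_def)
    then show "c *s v \<in> row_sum B ` Pow S" using v by (cases c) simp_all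
  qed
  moreover have "rows B \<subseteq> row_sum B ` Pow S"
  proof
    fix v assume "v \<in> rows B"
    then obtain i where i: "v = row i B" by (auto simp: rows_def)
    show "v \<in> row_sum B ` Pow S"
    proof (cases "i \<in> S")
      case True then show ?thesis by (intro image_eqI[where x="{i}"]) (auto simp: row_sum_def i)
    next
      case False then show ?thesis using assms by (intro image_eqI[where x="{}"]) (auto simp: row_sum_def i)
    qed
  qed
  ultimately show "vec.span (rows B) \<subseteq> row_sum B ` Pow S" by (rule vec.span_minimal[rotated])
  show "row_sum B ` Pow S \<subseteq> vec.span (rows B)"
  proof
    fix v assume "v \<in> row_sum B ` Pow S"
    then obtain g where "v = row_sum B g" by blast
    moreover have "row i B \<in> vec.span (rows B)" for i by (rule vec.span_base) (auto simp: rows_def)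
    ultimately show "v \<in> vec.span (rows B)" unfolding row_sum_def by (simp add: vec.span_sum)
  qed
qed

text \<open>For a basis \<open>D\<close> of \<open>R\<close> chosen inside \<open>R\<close>, the
  image of \<open>D\<close> spans the image of \<open>R\<close>. If the dimension is kept, this
  image has too few elements to be dependent.\<close>

lemma dim_image_eq_iff_inj_on_span:
  fixes f :: "'a::field^'n \<Rightarrow> 'a^'m"
  assumes f: "Vector_Spaces.linear (*s) (*s) f"
  shows "vec.dim (f ` R) = vec.dim R \<longleftrightarrow> inj_on f (vec.span R)"
proof
  assume "inj_on f (vec.span R)"
  with f show "vec.dim (f ` R) = vec.dim R" by (rule vec.dim_image_eq)
next
  assume eq: "vec.dim (f ` R) = vec.dim R"
  obtain D where D: "D \<subseteq> R" "vec.independent D" "R \<subseteq> vec.span D" "card D = vec.dim R"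
    using vec.basis_exists by blast
  have finD: "finite D" using D(2) vec.finiteI_independent by blast
  have sp: "vec.span D = vec.span R"
    using D(1,3) by (metis subset_antisym vec.span_mono vec.span_minimal vec.subspace_span)
  have "f ` R \<subseteq> vec.span (f ` D)"
    using D(3) vec.linear_span_image[OF f, of D] by blast
  then have "vec.dim (f ` R) \<le> card (f ` D)"
    using finD by (intro vec.dim_le_card) auto
  then have card: "card (f ` D) = card D"
    using eq D(4) card_image_le[OF finD, of f] by simp
  then have inj: "inj_on f D" using finD by (simp add: eq_card_imp_inj_on)
  have "vec.independent (f ` D)"
    by (rule vec.card_le_dim_spanning[where V = "f ` R"])
       (use D(1) \<open>f ` R \<subseteq> vec.span (f ` D)\<close> finD card eq D(4) in auto)
  then show "inj_on f (vec.span R)"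
    using vec.linear_inj_on_span_iff_independent_image[OF f] inj sp by metis
qed

text \<open>Restriction to the columns in \<open>S\<close> preserves the dimension of the row space
  exactly if it is injective there, so its kernel must contain no nonzero sum of rows from
  \<open>S\<close>.\<close>

lemma sub_rank_eq_iff:
  fixes B :: "bit^'n^'n"
  shows "sub_rank B S S = sub_rank B S UNIV \<longleftrightarrow>
    (\<forall>g \<subseteq> S. (\<forall>k\<in>S. row_sum B g $ k = 0) \<longrightarrow> row_sum B g = 0)"
proof -
  define M where "M = (\<chi> i k. if i \<in> S \<and> k \<in> (UNIV::'n set) then B$i$k else 0)"
  define N where "N = (\<chi> i k. if i \<in> S \<and> k \<in> S then B$i$k else 0)"
  define f :: "bit^'n \<Rightarrow> bit^'n" where "f v = (\<chi> k. if k \<in> S then v$k else 0)" for v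
  have f: "Vector_Spaces.linear (*s) (*s) f"
    by unfold_locales (auto simp: f_def vec_eq_iff)
  have "row i N = f (row i M)" for i by (auto simp: N_def M_def f_def row_def vec_eq_iff)
  then have fM: "f ` rows M = rows N" by (auto simp: rows_def)
  have "sub_rank B S S = sub_rank B S UNIV \<longleftrightarrow> vec.dim (f ` rows M) = vec.dim (rows M)"
    unfolding sub_rank_def M_def[symmetric] N_def[symmetric] row_rank_def_gen fM ..
  also have "\<dots> \<longleftrightarrow> inj_on f (vec.span (rows M))"
    by (rule dim_image_eq_iff_inj_on_span[OF f])
  also have "\<dots> \<longleftrightarrow> (\<forall>v \<in> vec.span (rows M). f v = 0 \<longrightarrow> v = 0)"
    by (rule vec.linear_inj_on_iff_eq_0[OF f]) simp
  also have "\<dots> \<longleftrightarrow> (\<forall>g \<subseteq> S. f (row_sum M g) = 0 \<longrightarrow> row_sum M g = 0)"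
  proof -
    have "row i M = 0" if "i \<notin> S" for i using that by (simp add: M_def row_def vec_eq_iff)
    then have "vec.span (rows M) = row_sum M ` Pow S" by (rule span_rows_bit)
    then show ?thesis by auto
  qed
  also have "\<dots> \<longleftrightarrow> (\<forall>g \<subseteq> S. (\<forall>k\<in>S. row_sum B g $ k = 0) \<longrightarrow> row_sum B g = 0)"
  proof -
    have "row_sum M g = row_sum B g" if "g \<subseteq> S" for g
      unfolding row_sum_def by (rule sum.cong) (use that in \<open>auto simp: M_def row_def vec_eq_iff\<close>)
    then show ?thesis by (auto simp: f_def vec_eq_iff)
  qed
  finally show ?thesis .
qed

lemma finite_rows: "finite (rows (B :: 'a^'n^'m::finite))"
proof -
  have "rows B = range (\<lambda>i. row i B)" by (auto simp: rows_def)
  then show ?thesis by simp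
qed

lemma row_sum_by_rows:
  fixes B :: "bit^'n^'m::finite"
  shows "row_sum B g = (\<Sum>v\<in>rows B. of_nat (card {i \<in> g. row i B = v}) *s v)"
proof -
  have "row_sum B g = (\<Sum>v\<in>rows B. \<Sum>i | i \<in> g \<and> row i B = v. row i B)"
    unfolding row_sum_def
    by (rule sum.group[symmetric, OF _ finite_rows]) (auto simp: rows_def)
  also have "\<dots> = (\<Sum>v\<in>rows B. of_nat (card {i \<in> g. row i B = v}) *s v)"
    by (intro sum.cong) (auto simp: vec_eq_iff)
  finally show ?thesis .
qed

text \<open>\<open>rows\<close> forgets repetitions, so the coefficient of a row in a sum over
  \<open>g\<close> is the parity of its multiplicity in \<open>g\<close>. Conversely, one index per
  row realises any given coefficients.\<close>

lemma independent_rows_iff: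
  fixes B :: "bit^'n^'m::finite"
  shows "(\<forall>V. V \<subseteq> rows B \<longrightarrow> vec.independent V) \<longleftrightarrow>
    (\<forall>g. row_sum B g = 0 \<longrightarrow> (\<forall>k. even (card {i \<in> g. row i B = row k B})))"
proof -
  have of_nat_bit: "of_nat n = (0::bit) \<longleftrightarrow> even n" for n
    by (induction n) auto
  have "(\<forall>V. V \<subseteq> rows B \<longrightarrow> vec.independent V) \<longleftrightarrow> vec.independent (rows B)"
    using vec.independent_mono by blast
  also have "\<dots> \<longleftrightarrow> (\<forall>g. row_sum B g = 0 \<longrightarrow> (\<forall>k. even (card {i \<in> g. row i B = row k B})))"
  proof (intro iffI allI impI)
    fix g k assume ind: "vec.independent (rows B)" and g: "row_sum B g = 0"
    have "of_nat (card {i \<in> g. row i B = row k B}) = (0::bit)"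
      by (rule vec.independentD[OF ind finite_rows subset_refl, where u="\<lambda>v. of_nat (card {i \<in> g. row i B = v})"])
         (use g row_sum_by_rows[of B g] in \<open>auto simp: rows_def\<close>)
    then show "even (card {i \<in> g. row i B = row k B})" by (simp only: of_nat_bit)
  next
    assume R: "\<forall>g. row_sum B g = 0 \<longrightarrow> (\<forall>k. even (card {i \<in> g. row i B = row k B}))"
    show "vec.independent (rows B)"
    proof (rule vec.independent_if_scalars_zero[OF finite_rows])
      fix u v assume u: "(\<Sum>x\<in>rows B. u x *s x) = 0" and v: "v \<in> rows B"
      define e where "e r = (SOME i :: 'm. row i B = r)" for r
      have e: "row (e r) B = r" if "r \<in> rows B" for r
        unfolding e_def by (rule someI_ex) (use that in \<open>auto simp: rows_def\<close>)
      define g where "g = e ` {r \<in> rows B. u r = 1}"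
      have ge: "{i \<in> g. row i B = r} = (if u r = 1 then {e r} else {})" if "r \<in> rows B" for r
        using e that by (auto simp: g_def)
      have "row_sum B g = (\<Sum>r\<in>rows B. u r *s r)"
        unfolding row_sum_by_rows
      proof (rule sum.cong)
        fix r assume r: "r \<in> rows B"
        show "of_nat (card {i \<in> g. row i B = r}) *s r = u r *s r"
          unfolding ge[OF r] by (cases "u r") simp_all
      qed simp
      then have "row_sum B g = 0" using u by simp
      then have "even (card {i \<in> g. row i B = v})" using R v by (auto simp: rows_def)
      then show "u v = 0" unfolding ge[OF v] by (cases "u v") simp_all
    qed
  qed
  finally show ?thesis .
qed

text \<open>Signs multiply as their exponents add. The zero diagonal makes each diagonal entry of
  \<open>A + mat 1\<close> equal to 1, matching the case \<open>k = i\<close> in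
  \<open>flip_sign\<close>.\<close>

lemma flip_sign_eq_1_iff:
  fixes A :: "bit^'n^'n"
  assumes "\<forall>i. A$i$i = 0"
  shows "flip_sign A g $ k = 1 \<longleftrightarrow> row_sum (A + mat 1) g $ k = 0"
proof -
  have entry: "(A + mat 1)$i$k = (if k = i \<or> A$i$k = 1 then 1 else 0)" for i
    using assms by (cases "A$i$k") (auto simp: mat_def)
  have "finite g" by simp
  then have "flip_sign A g $ k = (if row_sum (A + mat 1) g $ k = 0 then 1 else -1)"
    unfolding flip_sign_def row_sum_component entry vec_lambda_beta
  proof (induction g rule: finite_induct)
    case (insert i g)
    then show ?case by (cases "\<Sum>i\<in>g. if k = i \<or> A$i$k = 1 then 1 else 0 :: bit") auto
  qed simp
  then show ?thesis by simp
qed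

lemma equal_row_parity_iff:
  fixes A :: "bit^'n^'n"
  assumes "\<forall>i. A$i$i = 0"
  shows "equal_row_parity A g \<longleftrightarrow> (\<forall>k. even (card {i \<in> g. row i (A + mat 1) = row k (A + mat 1)}))"
proof -
  have entry: "(A + mat 1)$i$l = (if l = i \<or> A$i$l = 1 then 1 else 0)" for i l
    using assms by (cases "A$i$l") (auto simp: mat_def)
  have "row i (A + mat 1) = row k (A + mat 1) \<longleftrightarrow> (\<forall>l. (l = i \<or> A$i$l = 1) = (l = k \<or> A$k$l = 1))" for i k
    unfolding row_def vec_eq_iff vec_lambda_beta entry by (auto split: if_splits)
  then show ?thesis unfolding equal_row_parity_def by simp
qed

text \<open>If the sum of the rows in \<open>g\<close> vanishes on \<open>g\<close>, the rank
  condition with \<open>S = g\<close> makes it zero, and independence gives the parity. Conversely,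
  a sum vanishing on a superset \<open>S\<close> of \<open>g\<close> vanishes on \<open>g\<close>,
  and even multiplicities make it zero.\<close>

lemma rank_conditions_iff:
  fixes A :: "bit^'n^'n"
  assumes "\<forall>i. A$i$i = 0"
  shows "((\<forall>S::'n set. S \<noteq> {} \<longrightarrow> sub_rank (A + mat 1) S S = sub_rank (A + mat 1) S UNIV) \<and>
      (\<forall>V. V \<subseteq> rows (A + mat 1) \<longrightarrow> vec.independent V)) \<longleftrightarrow>
    (\<forall>g. (\<forall>k\<in>g. flip_sign A g $ k = 1) \<longrightarrow> equal_row_parity A g)"
    (is "?rank \<and> ?indep \<longleftrightarrow> ?parity")
proof -
  let ?B = "A + mat 1"
  have rank: "?rank \<longleftrightarrow> (\<forall>S. S \<noteq> {} \<longrightarrow> (\<forall>g \<subseteq> S. (\<forall>k\<in>S. row_sum ?B g $ k = 0) \<longrightarrow> row_sum ?B g = 0))"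
    by (simp only: sub_rank_eq_iff)
  have indep: "?indep \<longleftrightarrow> (\<forall>g. row_sum ?B g = 0 \<longrightarrow> equal_row_parity A g)"
    by (simp only: independent_rows_iff equal_row_parity_iff[OF assms])
  have parity: "?parity \<longleftrightarrow> (\<forall>g. (\<forall>k\<in>g. row_sum ?B g $ k = 0) \<longrightarrow> equal_row_parity A g)"
    by (simp only: flip_sign_eq_1_iff[OF assms])
  have zero: "row_sum ?B g = 0" if "equal_row_parity A g" for g
  proof -
    have "row_sum ?B g $ k = 0" for k
      using flip_sign_equal_row_parity[OF that] flip_sign_eq_1_iff[OF assms, of g k] by simp
    then show ?thesis by (simp add: vec_eq_iff)
  qed
  show ?thesis
    unfolding rank indep parity
  proof (intro iffI conjI allI impI)
    fix g
    assume R: "(\<forall>S. S \<noteq> {} \<longrightarrow> (\<forall>g \<subseteq> S. (\<forall>k\<in>S. row_sum ?B g $ k = 0) \<longrightarrow> row_sum ?B g = 0)) \<and>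
        (\<forall>g. row_sum ?B g = 0 \<longrightarrow> equal_row_parity A g)"
      and g: "\<forall>k\<in>g. row_sum ?B g $ k = 0"
    have "row_sum ?B g = 0"
    proof (cases "g = {}")
      case True then show ?thesis by (simp add: row_sum_def)
    next
      case False then show ?thesis using R g by blast
    qed
    then show "equal_row_parity A g" using R by blast
  next
    fix S g :: "'n set"
    assume "\<forall>g. (\<forall>k\<in>g. row_sum ?B g $ k = 0) \<longrightarrow> equal_row_parity A g" "g \<subseteq> S" "\<forall>k\<in>S. row_sum ?B g $ k = 0"
    then have "equal_row_parity A g" by blast
    then show "row_sum ?B g = 0" by (rule zero)
  next
    fix g
    assume R: "\<forall>g. (\<forall>k\<in>g. row_sum ?B g $ k = 0) \<longrightarrow> equal_row_parity A g" and "row_sum ?B g = 0"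
    then have "\<forall>k\<in>g. row_sum ?B g $ k = 0" by simp
    then show "equal_row_parity A g" using R by blast
  qed
qed

theorem mainTheorem19:
  fixes A :: "bit^'n^'n"
  assumes "\<forall>i. A$i$i = 0"
  shows "closed_manifold (seal_space A) TYPE('n) \<longleftrightarrow>
    ((\<forall>S::'n set. S \<noteq> {} \<longrightarrow>
        sub_rank (A + mat 1) S S = sub_rank (A + mat 1) S UNIV) \<and>
     (\<forall>V. V \<subseteq> rows (A + mat 1) \<longrightarrow> vec.independent V))"
  unfolding rank_conditions_iff[OF assms]
  using closed_manifold_seal_space[of A] not_closed_manifold_seal_space[of _ A] by blast

end
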